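(* Suppose that the $\mathbb{N}$-based Smullyan model $M_{\mathbb{N}}$ satisfies G1$^+$, i.e. for any $H\in\mathrm{Pred}$ with $\Phi_{\mathbb{N}}(H)\cap\mathrm{Sent}^+\subseteq\mathrm{True}_{M_{\mathbb{N}}}^+$ there exists $S\in\mathrm{Sent}^+$ such that $S\notin\Phi_{\mathbb{N}}(H)$ and $\mathsf{n}S\notin\Phi_{\mathbb{N}}(H)$. Then every arithmetically definable sound $\mathcal{L}_A$-theory is incomplete.
   Context: Arithmetic. $\mathcal{L}_A$ is the language of first-order arithmetic, containing a function symbol for each primitive recursive function; $\mathbb{N}$ is also the standard $\mathcal{L}_A$-structure; $\overline{n}$ is the numeral of $n$. Fix a natural Gödel numbering; $\ulcorner\psi\urcorner$ is the Gödel number of $\psi$, and inside formulas also its numeral. An $\mathcal{L}_A$-theory $T$ is arithmetically definable if the set of Gödel numbers of elements of $T$ is definable in $\mathbb{N}$ by an $\mathcal{L}_A$-formula; sound if every $\mathcal{L}_A$-sentence provable in $T$ is true in $\mathbb{N}$; incomplete if for some $\mathcal{L}_A$-sentence $\theta$, $T\nvdash\theta$ and $T\nvdash\neg\theta$. Fix a variable $v$. A $v$-formula is an $\mathcal{L}_A$-formula with no free variables other than $v$ (possibly none); $\varphi_i(v)$ is the $v$-formula with Gödel number $i$; $\Gamma$ is the set of Gödel numbers of $v$-formulas; $\psi(t)$ is the result of substituting the term $t$ for $v$ in $\psi(v)$. $d$ is the primitive recursive function (and its function symbol) with $d(i)=\ulcorner\varphi_i(\overline{i})\urcorner$ if $i\in\Gamma$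 and $d(i)=0$ otherwise. $\equiv$ is syntactic identity and $\neg^k$ is a string of $k$ negations. Frame. Let $\mathsf{n},\mathsf{r},a_i$ $(i\in\Gamma)$ be pairwise distinct symbols, $\Sigma=\{a_i: i\in\Gamma\}\cup\{\mathsf{n},\mathsf{r}\}$, $\Sigma^\ast$ the set of finite strings over $\Sigma$ (including the empty string $\epsilon$), $\mathrm{Pred}=\{Xa_i: X\in\{\mathsf{n},\mathsf{r}\}^\ast, i\in\Gamma\}$, $\mathrm{Sent}=\{HX: H\in\mathrm{Pred}, X\in\Sigma^\ast\}$ (the decomposition $HX$ is unique), $\mathrm{Sent}^+=\mathrm{Sent}\setminus\mathrm{Pred}$. Map $I$ from $\mathrm{Pred}$ to $v$-formulas: $I(\mathsf{n}^k a_i)\equiv\neg^k\varphi_i(v)$; $I(\mathsf{n}^k\mathsf{r}\mathsf{n}^l a_i)\equiv\neg^{k+l}\varphi_i(d(v))$; $I(\mathsf{n}^k\mathsf{r}\mathsf{n}^l\mathsf{r}Y a_i)\equiv\neg^{k+l}\bot$ ($k,l\ge0$, $Y\in\{\mathsf{n},\mathsf{r}\}^\ast$). Map $J$ from $\mathrm{Sent}$ to $\mathcal{L}_A$-sentences, defined inductively for $H\in\mathrm{Pred}$, $X\in\Sigma^\ast$: if $X\in\mathrm{Pred}$, $J(HX)\equiv I(H)(\ulcorner I(X)(v)\urcorner)$; if $X\notin\mathrm{Sent}$, $J(a_iX)\equiv I(a_i)(0)$, $J(\mathsf{r}HX)\equiv\bot$, $J(\mathsf{n}HX)\equiv\neg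 J(HX)$; if $X\in\mathrm{Sent}^+$, $J(a_iX)\equiv I(a_i)(\ulcorner J(X)\urcorner)$, $J(\mathsf{r}HX)\equiv\bot$, $J(\mathsf{n}HX)\equiv\neg J(HX)$. Model. $M_{\mathbb{N}}=(\Sigma,\mathrm{Pred},\Phi_{\mathbb{N}})$ with $\Phi_{\mathbb{N}}(H)=\{X\in\Sigma^\ast: \mathbb{N}\models J(HX)\}$. $\mathrm{True}_{M_{\mathbb{N}}}=\{HX: H\in\mathrm{Pred}, X\in\Phi_{\mathbb{N}}(H)\}$ and $\mathrm{True}_{M_{\mathbb{N}}}^+=\mathrm{True}_{M_{\mathbb{N}}}\cap\mathrm{Sent}^+$. *)

theory Defs
  imports "HOL-Library.Nat_Bijection"
begin

subsection \<open>Primitive recursive function symbols\<close>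

text \<open>The function symbols of the language are the definitions of primitive recursive functions,
  so that every primitive recursive function has (at least) one symbol and the symbols can be
  effectively numbered. \<open>Zero\<close> is the individual constant 0. \<open>PRec f g\<close> is recursion
  on the first argument: \<open>h(0,x) = f(x)\<close>, \<open>h(k+1,x) = g(k,h(k,x),x)\<close>.\<close>

datatype fsym =
    Zero
  | Succ
  | Proj nat nat
  | Comp nat fsym "fsym list"
  | PRec fsym fsym

fun arity :: "fsym \<Rightarrow> nat" where
  "arity Zero = 0"
| "arity Succ = 1"
| "arity (Proj n i) = n"
| "arity (Comp n f gs) = n"
| "arity (PRec f g) = Suc (arity f)"

fun wf_fsym :: "fsym \<Rightarrow> bool" where
  "wf_fsym Zero = True"
| "wf_fsym Succ = True"
| "wf_fsym (Proj n i) = (i < n)"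
| "wf_fsym (Comp n f gs) =
     (wf_fsym f \<and> arity f = length gs \<and> (\<forall>g\<in>set gs. wf_fsym g \<and> arity g = n))"
| "wf_fsym (PRec f g) = (wf_fsym f \<and> wf_fsym g \<and> arity g = arity f + 2)"

fun fsym_val :: "fsym \<Rightarrow> nat list \<Rightarrow> nat" where
  "fsym_val Zero xs = 0"
| "fsym_val Succ xs = Suc (hd xs)"
| "fsym_val (Proj n i) xs = xs ! i"
| "fsym_val (Comp n f gs) xs = fsym_val f (map (\<lambda>g. fsym_val g xs) gs)"
| "fsym_val (PRec f g) xs =
     rec_nat (fsym_val f (tl xs)) (\<lambda>k r. fsym_val g (k # r # tl xs)) (hd xs)"


subsection \<open>The language of arithmetic\<close>

text \<open>Raw terms and formulas; those of the language are singled out by \<open>wf_tm\<close> and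
  \<open>wf_fm\<close>, which enforce arities. Variables are named by natural numbers. Equality is the
  only relation symbol; \<open>\<bottom>\<close>, \<open>\<longrightarrow>\<close> and \<open>\<forall>\<close> are primitive, and \<open>\<not>\<close> is
  implication of \<open>\<bottom>\<close>.\<close>

datatype tm = Var nat | Fn fsym "tm list"

datatype fm = Bot | Eq tm tm | Imp fm fm | All nat fm

abbreviation Neg :: "fm \<Rightarrow> fm" where
  "Neg p \<equiv> Imp p Bot"

fun wf_tm :: "tm \<Rightarrow> bool" where
  "wf_tm (Var x) = True"
| "wf_tm (Fn f ts) = (wf_fsym f \<and> arity f = length ts \<and> (\<forall>t\<in>set ts. wf_tm t))"

fun wf_fm :: "fm \<Rightarrow> bool" where
  "wf_fm Bot = True"
| "wf_fm (Eq s t) = (wf_tm s \<and> wf_tm t)"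
| "wf_fm (Imp p q) = (wf_fm p \<and> wf_fm q)"
| "wf_fm (All x p) = wf_fm p"

fun vars_tm :: "tm \<Rightarrow> nat set" where
  "vars_tm (Var x) = {x}"
| "vars_tm (Fn f ts) = (\<Union>t\<in>set ts. vars_tm t)"

fun fv :: "fm \<Rightarrow> nat set" where
  "fv Bot = {}"
| "fv (Eq s t) = vars_tm s \<union> vars_tm t"
| "fv (Imp p q) = fv p \<union> fv q"
| "fv (All x p) = fv p - {x}"

definition sentence :: "fm \<Rightarrow> bool" where
  "sentence p \<longleftrightarrow> wf_fm p \<and> fv p = {}"

definition v_formula :: "nat \<Rightarrow> fm \<Rightarrow> bool" where
  "v_formula v p \<longleftrightarrow> wf_fm p \<and> fv p \<subseteq> {v}"

fun numeral_tm :: "nat \<Rightarrow> tm" where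
  "numeral_tm 0 = Fn Zero []"
| "numeral_tm (Suc n) = Fn Succ [numeral_tm n]"

fun subst_tm :: "nat \<Rightarrow> tm \<Rightarrow> tm \<Rightarrow> tm" where
  "subst_tm x u (Var y) = (if y = x then u else Var y)"
| "subst_tm x u (Fn f ts) = Fn f (map (subst_tm x u) ts)"

text \<open>\<open>subst x u p\<close> replaces the free occurrences of \<open>x\<close> in \<open>p\<close> by
  \<open>u\<close>, without renaming bound variables; capture is excluded by \<open>free_for\<close>. The terms
  substituted for \<open>v\<close> in \<open>v\<close>-formulas below contain no variable other than \<open>v\<close>,
  and there no capture can occur (lemma \<open>free_for_same\<close>).\<close>

fun subst :: "nat \<Rightarrow> tm \<Rightarrow> fm \<Rightarrow> fm" where
  "subst x u Bot = Bot"
| "subst x u (Eq s t) = Eq (subst_tm x u s) (subst_tm x u t)"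
| "subst x u (Imp p q) = Imp (subst x u p) (subst x u q)"
| "subst x u (All y p) = All y (if y = x then p else subst x u p)"

fun free_for :: "tm \<Rightarrow> nat \<Rightarrow> fm \<Rightarrow> bool" where
  "free_for u x Bot = True"
| "free_for u x (Eq s t) = True"
| "free_for u x (Imp p q) = (free_for u x p \<and> free_for u x q)"
| "free_for u x (All y p) = (x \<notin> fv (All y p) \<or> (y \<notin> vars_tm u \<and> free_for u x p))"

lemma free_for_same: "vars_tm u \<subseteq> {x} \<Longrightarrow> free_for u x p"
  by (induction p) auto


subsection \<open>Truth in the standard model\<close>

fun tm_val :: "(nat \<Rightarrow> nat) \<Rightarrow> tm \<Rightarrow> nat" where
  "tm_val e (Var x) = e x"
| "tm_val e (Fn f ts) = fsym_val f (map (tm_val e) ts)"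

fun sat :: "(nat \<Rightarrow> nat) \<Rightarrow> fm \<Rightarrow> bool" where
  "sat e Bot = False"
| "sat e (Eq s t) = (tm_val e s = tm_val e t)"
| "sat e (Imp p q) = (sat e p \<longrightarrow> sat e q)"
| "sat e (All x p) = (\<forall>a. sat (e(x := a)) p)"

definition true_N :: "fm \<Rightarrow> bool" where
  "true_N p \<longleftrightarrow> (\<forall>e. sat e p)"


subsection \<open>Goedel numbering\<close>

fun code_fsym :: "fsym \<Rightarrow> nat" where
  "code_fsym Zero = prod_encode (0, 0)"
| "code_fsym Succ = prod_encode (1, 0)"
| "code_fsym (Proj n i) = prod_encode (2, prod_encode (n, i))"
| "code_fsym (Comp n f gs) =
     prod_encode (3, prod_encode (n, prod_encode (code_fsym f, list_encode (map code_fsym gs))))"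
| "code_fsym (PRec f g) = prod_encode (4, prod_encode (code_fsym f, code_fsym g))"

fun code_tm :: "tm \<Rightarrow> nat" where
  "code_tm (Var x) = prod_encode (0, x)"
| "code_tm (Fn f ts) = prod_encode (1, prod_encode (code_fsym f, list_encode (map code_tm ts)))"

fun gnum :: "fm \<Rightarrow> nat" where
  "gnum Bot = prod_encode (0, 0)"
| "gnum (Eq s t) = prod_encode (1, prod_encode (code_tm s, code_tm t))"
| "gnum (Imp p q) = prod_encode (2, prod_encode (gnum p, gnum q))"
| "gnum (All x p) = prod_encode (3, prod_encode (x, gnum p))"

lemma code_fsym_inj: "code_fsym f = code_fsym g \<Longrightarrow> f = g"
proof (induction f arbitrary: g)
  case Zero
  then show ?case by (cases g) auto
next
  case Succ
  then show ?case by (cases g) auto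
next
  case (Proj n i)
  then show ?case by (cases g) auto
next
  case (Comp n f gs)
  from Comp.prems obtain f' gs' where g: "g = Comp n f' gs'" "code_fsym f = code_fsym f'"
    "map code_fsym gs = map code_fsym gs'"
    by (cases g) (auto simp: list_encode_eq)
  have "f = f'" using g(2) Comp.IH(1) by blast
  moreover have "gs = gs'"
    using g(3) Comp.IH(2) by (metis list.inj_map_strong)
  ultimately show ?case using g(1) by simp
next
  case (PRec f1 f2)
  then show ?case by (cases g) auto
qed

lemma code_tm_inj: "code_tm s = code_tm t \<Longrightarrow> s = t"
proof (induction s arbitrary: t)
  case (Var x)
  then show ?case by (cases t) auto
next
  case (Fn f ts)
  from Fn.prems obtain ts' where t: "t = Fn f ts'" "map code_tm ts = map code_tm ts'"
    by (cases t) (auto simp: list_encode_eq dest: code_fsym_inj)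
  have "ts = ts'"
    using t(2) Fn.IH by (metis list.inj_map_strong)
  then show ?case using t(1) by simp
qed

lemma gnum_inj: "gnum p = gnum q \<Longrightarrow> p = q"
proof (induction p arbitrary: q)
  case Bot
  then show ?case by (cases q) auto
next
  case (Eq s t)
  then show ?case by (cases q) (auto dest: code_tm_inj)
next
  case (Imp p1 p2)
  then show ?case by (cases q) auto
next
  case (All x p)
  then show ?case by (cases q) auto
qed


subsection \<open>Provability and properties of theories\<close>

text \<open>A complete Hilbert calculus for first-order logic with equality. Hypotheses are meant to
  be sentences, so the generalization rule is unrestricted.\<close>

inductive proves :: "fm set \<Rightarrow> fm \<Rightarrow> bool" for T :: "fm set" where
  hyp: "p \<in> T \<Longrightarrow> proves T p"
| K: "wf_fm p \<Longrightarrow> wf_fm q \<Longrightarrow> proves T (Imp p (Imp q p))"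
| S: "wf_fm p \<Longrightarrow> wf_fm q \<Longrightarrow> wf_fm r \<Longrightarrow>
     proves T (Imp (Imp p (Imp q r)) (Imp (Imp p q) (Imp p r)))"
| dne: "wf_fm p \<Longrightarrow> proves T (Imp (Neg (Neg p)) p)"
| inst: "wf_fm p \<Longrightarrow> wf_tm t \<Longrightarrow> free_for t x p \<Longrightarrow>
     proves T (Imp (All x p) (subst x t p))"
| dist: "wf_fm p \<Longrightarrow> wf_fm q \<Longrightarrow> x \<notin> fv p \<Longrightarrow>
     proves T (Imp (All x (Imp p q)) (Imp p (All x q)))"
| eq_refl: "wf_tm t \<Longrightarrow> proves T (Eq t t)"
| eq_subst: "wf_fm p \<Longrightarrow> wf_tm s \<Longrightarrow> wf_tm t \<Longrightarrow> free_for s x p \<Longrightarrow> free_for t x p \<Longrightarrow>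
     proves T (Imp (Eq s t) (Imp (subst x s p) (subst x t p)))"
| mp: "proves T (Imp p q) \<Longrightarrow> proves T p \<Longrightarrow> proves T q"
| gen: "proves T p \<Longrightarrow> proves T (All x p)"

definition is_theory :: "fm set \<Rightarrow> bool" where
  "is_theory T \<longleftrightarrow> (\<forall>p\<in>T. sentence p)"

definition definable_N :: "nat set \<Rightarrow> bool" where
  "definable_N A \<longleftrightarrow>
     (\<exists>p x. wf_fm p \<and> fv p \<subseteq> {x} \<and> (\<forall>n e. n \<in> A \<longleftrightarrow> sat (e(x := n)) p))"

definition arithmetically_definable :: "fm set \<Rightarrow> bool" where
  "arithmetically_definable T \<longleftrightarrow> definable_N (gnum ` T)"

definition sound :: "fm set \<Rightarrow> bool" where
  "sound T \<longleftrightarrow> (\<forall>p. sentence p \<and> proves T p \<longrightarrow> true_N p)"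

definition incomplete :: "fm set \<Rightarrow> bool" where
  "incomplete T \<longleftrightarrow> (\<exists>p. sentence p \<and> \<not> proves T p \<and> \<not> proves T (Neg p))"


subsection \<open>Diagonalization\<close>

text \<open>The distinguished variable \<open>v\<close> is a parameter throughout.\<close>

definition Gamma :: "nat \<Rightarrow> nat set" where
  "Gamma v = {gnum p | p. v_formula v p}"

definition phi :: "nat \<Rightarrow> nat \<Rightarrow> fm" where
  "phi v i = (THE p. v_formula v p \<and> gnum p = i)"

lemma phi_gnum: "v_formula v p \<Longrightarrow> phi v (gnum p) = p"
  unfolding phi_def by (rule the_equality) (auto dest: gnum_inj)

definition diag :: "nat \<Rightarrow> nat \<Rightarrow> nat" where
  "diag v i = (if i \<in> Gamma v then gnum (subst v (numeral_tm i) (phi v i)) else 0)"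

text \<open>A function symbol for \<open>diag v\<close>; it exists by lemma \<open>diag_sym\<close> at the end.\<close>

definition diag_sym :: "nat \<Rightarrow> fsym" where
  "diag_sym v = (SOME f. wf_fsym f \<and> arity f = 1 \<and> (\<forall>i. fsym_val f [i] = diag v i))"


subsection \<open>The frame\<close>

datatype letter = Ln | Lr | La nat

definition Sigma_N :: "nat \<Rightarrow> letter set" where
  "Sigma_N v = {Ln, Lr} \<union> La ` Gamma v"

definition Pred_N :: "nat \<Rightarrow> letter list set" where
  "Pred_N v = {X @ [La i] | X i. X \<in> lists {Ln, Lr} \<and> i \<in> Gamma v}"

definition Sent_N :: "nat \<Rightarrow> letter list set" where
  "Sent_N v = {H @ X | H X. H \<in> Pred_N v \<and> X \<in> lists (Sigma_N v)}"

abbreviation negs :: "nat \<Rightarrow> fm \<Rightarrow> fm" where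
  "negs k p \<equiv> (Neg ^^ k) p"

text \<open>Recursive versions of the maps \<open>I\<close> and \<open>J\<close>, computed on arbitrary strings of
  letters (values outside \<open>Pred_N v\<close> and \<open>Sent_N v\<close> are irrelevant); their defining
  clauses on \<open>Pred_N v\<close> and \<open>Sent_N v\<close> are lemmas \<open>I_map_clauses\<close> and
  \<open>J_map_clauses\<close>.\<close>

fun I_map :: "nat \<Rightarrow> letter list \<Rightarrow> fm" where
  "I_map v [] = Bot"
| "I_map v (La i # X) = phi v i"
| "I_map v (Ln # X) = Neg (I_map v X)"
| "I_map v (Lr # X) =
     negs (length (takeWhile (\<lambda>a. a = Ln) X))
       (case dropWhile (\<lambda>a. a = Ln) X of
          La i # Y \<Rightarrow> subst v (Fn (diag_sym v) [Var v]) (phi v i)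
        | _ \<Rightarrow> Bot)"

text \<open>The unique decomposition \<open>HX\<close> of a string in \<open>Sent_N v\<close>: \<open>H\<close> ends with
  the first letter of the form \<open>La i\<close>.\<close>

fun pred_part :: "letter list \<Rightarrow> letter list" where
  "pred_part [] = []"
| "pred_part (La i # X) = [La i]"
| "pred_part (Ln # X) = Ln # pred_part X"
| "pred_part (Lr # X) = Lr # pred_part X"

fun arg_part :: "letter list \<Rightarrow> letter list" where
  "arg_part [] = []"
| "arg_part (La i # X) = X"
| "arg_part (Ln # X) = arg_part X"
| "arg_part (Lr # X) = arg_part X"

fun J_map :: "nat \<Rightarrow> letter list \<Rightarrow> fm" where
  "J_map v [] = Bot"
| "J_map v (La i # X) =
     (if X \<in> Pred_N v then subst v (numeral_tm (gnum (I_map v X))) (I_map v [La i])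
      else if X \<in> Sent_N v then subst v (numeral_tm (gnum (J_map v X))) (I_map v [La i])
      else subst v (numeral_tm 0) (I_map v [La i]))"
| "J_map v (Lr # S) =
     (if arg_part S \<in> Pred_N v
      then subst v (numeral_tm (gnum (I_map v (arg_part S)))) (I_map v (Lr # pred_part S))
      else Bot)"
| "J_map v (Ln # S) =
     (if arg_part S \<in> Pred_N v
      then subst v (numeral_tm (gnum (I_map v (arg_part S)))) (I_map v (Ln # pred_part S))
      else Neg (J_map v S))"

lemma takeWhile_replicate_N: "takeWhile (\<lambda>a. a = Ln) (replicate l Ln @ a # Y) = replicate l Ln"
  if "a \<noteq> Ln" using that by (induction l) auto

lemma dropWhile_replicate_N: "dropWhile (\<lambda>a. a = Ln) (replicate l Ln @ a # Y) = a # Y"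
  if "a \<noteq> Ln" using that by (induction l) auto

lemma I_map_replicate_N: "I_map v (replicate k Ln @ X) = negs k (I_map v X)"
  by (induction k) auto

lemma I_map_clauses:
  "I_map v (replicate k Ln @ [La i]) = negs k (phi v i)"
  "I_map v (replicate k Ln @ [Lr] @ replicate l Ln @ [La i]) =
     negs (k + l) (subst v (Fn (diag_sym v) [Var v]) (phi v i))"
  "I_map v (replicate k Ln @ [Lr] @ replicate l Ln @ [Lr] @ Y @ [La i]) = negs (k + l) Bot"
  by (simp_all add: I_map_replicate_N takeWhile_replicate_N dropWhile_replicate_N funpow_add)

lemma parts_append:
  "H \<in> Pred_N v \<Longrightarrow> pred_part (H @ X) = H" "H \<in> Pred_N v \<Longrightarrow> arg_part (H @ X) = X"
proof -
  have "pred_part ((Y @ [La i]) @ X) = Y @ [La i] \<and> arg_part ((Y @ [La i]) @ X) = X"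
    if "set Y \<subseteq> {Ln, Lr}" for Y i
    using that by (induction Y) auto
  then show "H \<in> Pred_N v \<Longrightarrow> pred_part (H @ X) = H" "H \<in> Pred_N v \<Longrightarrow> arg_part (H @ X) = X"
    unfolding Pred_N_def by (auto simp: lists_eq_set simp del: append_assoc)
qed

lemma J_map_clauses:
  shows "\<lbrakk>H \<in> Pred_N v; X \<in> Pred_N v\<rbrakk> \<Longrightarrow>
           J_map v (H @ X) = subst v (numeral_tm (gnum (I_map v X))) (I_map v H)"
    and "\<lbrakk>i \<in> Gamma v; X \<in> lists (Sigma_N v); X \<notin> Sent_N v\<rbrakk> \<Longrightarrow>
           J_map v ([La i] @ X) = subst v (numeral_tm 0) (I_map v [La i])"
    and "\<lbrakk>i \<in> Gamma v; X \<in> Sent_N v - Pred_N v\<rbrakk> \<Longrightarrow>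
           J_map v ([La i] @ X) = subst v (numeral_tm (gnum (J_map v X))) (I_map v [La i])"
    and "\<lbrakk>H \<in> Pred_N v; X \<in> lists (Sigma_N v); X \<notin> Sent_N v \<or> X \<in> Sent_N v - Pred_N v\<rbrakk> \<Longrightarrow>
           J_map v (Lr # H @ X) = Bot"
    and "\<lbrakk>H \<in> Pred_N v; X \<in> lists (Sigma_N v); X \<notin> Sent_N v \<or> X \<in> Sent_N v - Pred_N v\<rbrakk> \<Longrightarrow>
           J_map v (Ln # H @ X) = Neg (J_map v (H @ X))"
proof -
  have PS: "X \<in> Sent_N v" if "X \<in> Pred_N v" for X
    using that unfolding Sent_N_def by force
  show "J_map v (H @ X) = subst v (numeral_tm (gnum (I_map v X))) (I_map v H)"
    if H: "H \<in> Pred_N v" and X: "X \<in> Pred_N v"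
  proof (cases "H @ X" rule: pred_part.cases)
    case 1
    then show ?thesis using H by (auto simp: Pred_N_def)
  next
    case (2 i Y)
    then have "H = [La i]" "X = Y" using parts_append[OF H, of X] by auto
    then show ?thesis using X by simp
  next
    case (3 Y)
    then show ?thesis using parts_append[OF H, of X] X by simp
  next
    case (4 Y)
    then show ?thesis using parts_append[OF H, of X] X by (simp del: I_map.simps)
  qed
qed (use parts_append in \<open>auto simp: Sent_N_def\<close>)


subsection \<open>Smullyan models\<close>

text \<open>A model is a triple of an alphabet, a set of predicates, and the map \<open>\<Phi>\<close> from
  predicates to sets of strings.\<close>

type_synonym smullyan_model =
  "letter set \<times> letter list set \<times> (letter list \<Rightarrow> letter list set)"

fun Sent_of :: "smullyan_model \<Rightarrow> letter list set" where
  "Sent_of (\<Sigma>, P, \<Phi>) = {H @ X | H X. H \<in> P \<and> X \<in> lists \<Sigma>}"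

fun Sent_plus :: "smullyan_model \<Rightarrow> letter list set" where
  "Sent_plus (\<Sigma>, P, \<Phi>) = Sent_of (\<Sigma>, P, \<Phi>) - P"

fun True_of :: "smullyan_model \<Rightarrow> letter list set" where
  "True_of (\<Sigma>, P, \<Phi>) = {H @ X | H X. H \<in> P \<and> X \<in> \<Phi> H}"

fun True_plus :: "smullyan_model \<Rightarrow> letter list set" where
  "True_plus (\<Sigma>, P, \<Phi>) = True_of (\<Sigma>, P, \<Phi>) \<inter> Sent_plus (\<Sigma>, P, \<Phi>)"

fun G1_plus :: "smullyan_model \<Rightarrow> bool" where
  "G1_plus (\<Sigma>, P, \<Phi>) \<longleftrightarrow>
     (\<forall>H\<in>P. \<Phi> H \<inter> Sent_plus (\<Sigma>, P, \<Phi>) \<subseteq> True_plus (\<Sigma>, P, \<Phi>) \<longrightarrow>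
        (\<exists>S\<in>Sent_plus (\<Sigma>, P, \<Phi>). S \<notin> \<Phi> H \<and> Ln # S \<notin> \<Phi> H))"

definition Phi_N :: "nat \<Rightarrow> letter list \<Rightarrow> letter list set" where
  "Phi_N v H = {X \<in> lists (Sigma_N v). true_N (J_map v (H @ X))}"

definition M_N :: "nat \<Rightarrow> smullyan_model" where
  "M_N v = (Sigma_N v, Pred_N v, Phi_N v)"

lemma Sent_of_M_N: "Sent_of (M_N v) = Sent_N v"
  by (simp add: M_N_def Sent_N_def)

subsection \<open>The diagonal function is primitive recursive\<close>

definition PR :: "nat \<Rightarrow> (nat list \<Rightarrow> nat) \<Rightarrow> bool" where
  "PR n f \<longleftrightarrow>
     (\<exists>s. wf_fsym s \<and> arity s = n \<and> (\<forall>xs. length xs = n \<longrightarrow> fsym_val s xs = f xs))"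

lemma PR_cong: "PR n f \<Longrightarrow> (\<And>xs. length xs = n \<Longrightarrow> f xs = g xs) \<Longrightarrow> PR n g"
  unfolding PR_def by auto

named_theorems pr

lemma PR_nth [pr]: "i < n \<Longrightarrow> PR n (\<lambda>xs. xs ! i)"
  unfolding PR_def by (rule exI[of _ "Proj n i"]) auto

lemma PR_nth_tl [pr]: "Suc i < n \<Longrightarrow> PR n (\<lambda>xs. tl xs ! i)"
  by (rule PR_cong[OF PR_nth[of "Suc i"]]) (auto simp: nth_tl)

lemma PR_nth_tl2 [pr]: "Suc (Suc i) < n \<Longrightarrow> PR n (\<lambda>xs. tl (tl xs) ! i)"
  by (rule PR_cong[OF PR_nth[of "Suc (Suc i)"]]) (auto simp: nth_tl)

lemma PR_nth_tl3 [pr]: "Suc (Suc (Suc i)) < n \<Longrightarrow> PR n (\<lambda>xs. tl (tl (tl xs)) ! i)"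
  by (rule PR_cong[OF PR_nth[of "Suc (Suc (Suc i))"]]) (auto simp: nth_tl)

lemma PR_nth_tl4 [pr]: "Suc (Suc (Suc (Suc i))) < n \<Longrightarrow> PR n (\<lambda>xs. tl (tl (tl (tl xs))) ! i)"
  by (rule PR_cong[OF PR_nth[of "Suc (Suc (Suc (Suc i)))"]]) (auto simp: nth_tl)

lemma PR_Suc [pr]: "PR n f \<Longrightarrow> PR n (\<lambda>xs. Suc (f xs))"
proof -
  assume "PR n f"
  then obtain s where "wf_fsym s" "arity s = n" "\<forall>xs. length xs = n \<longrightarrow> fsym_val s xs = f xs"
    unfolding PR_def by blast
  then show ?thesis
    unfolding PR_def by (intro exI[of _ "Comp n Succ [s]"]) auto
qed

lemma PR_const [pr]: "PR n (\<lambda>xs. c)"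
proof (induction c)
  case 0
  show ?case unfolding PR_def by (rule exI[of _ "Comp n Zero []"]) auto
qed (rule PR_Suc)

lemma PR_rec:
  assumes "PR n f" "PR (Suc (Suc n)) g" "PR n a"
  shows "PR n (\<lambda>xs. rec_nat (f xs) (\<lambda>k r. g (k # r # xs)) (a xs))"
proof -
  from assms obtain s t u where
    s: "wf_fsym s" "arity s = n" "\<forall>xs. length xs = n \<longrightarrow> fsym_val s xs = f xs" and
    t: "wf_fsym t" "arity t = Suc (Suc n)" "\<forall>xs. length xs = Suc (Suc n) \<longrightarrow> fsym_val t xs = g xs" and
    u: "wf_fsym u" "arity u = n" "\<forall>xs. length xs = n \<longrightarrow> fsym_val u xs = a xs"
    unfolding PR_def by blast
  have *: "map ((!) xs) [0..<n] = xs" if "length xs = n" for xs :: "nat list"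
    using that map_nth by blast
  show ?thesis
    unfolding PR_def
    using s t u *
    by (intro exI[of _ "Comp n (PRec s t) (u # map (Proj n) [0..<n])"]) (auto simp: comp_def)
qed

lemma PR_rec' [pr]:
  assumes "PR n f" "PR (Suc (Suc n)) (\<lambda>ys. g (ys ! 0) (ys ! 1) (tl (tl ys)))" "PR n a"
  shows "PR n (\<lambda>xs. rec_nat (f xs) (\<lambda>k r. g k r xs) (a xs))"
  using PR_rec[OF assms] by simp

lemma PR_pred [pr]: "PR n f \<Longrightarrow> PR n (\<lambda>xs. f xs - Suc 0)"
proof -
  assume "PR n f"
  then have "PR n (\<lambda>xs. rec_nat 0 (\<lambda>k r. k) (f xs))"
    by (intro pr) auto
  moreover have "rec_nat 0 (\<lambda>k r. k) m = m - Suc 0" for m :: nat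
    by (cases m) auto
  ultimately show ?thesis by simp
qed

lemma PR_add [pr]: "PR n f \<Longrightarrow> PR n g \<Longrightarrow> PR n (\<lambda>xs. f xs + g xs)"
proof -
  assume "PR n f" "PR n g"
  then have "PR n (\<lambda>xs. rec_nat (f xs) (\<lambda>k r. Suc r) (g xs))"
    by (intro pr) auto
  moreover have "rec_nat a (\<lambda>k r. Suc r) m = a + m" for a m :: nat
    by (induction m) auto
  ultimately show ?thesis by simp
qed

lemma PR_sub [pr]: "PR n f \<Longrightarrow> PR n g \<Longrightarrow> PR n (\<lambda>xs. f xs - g xs)"
proof -
  assume "PR n f" "PR n g"
  then have "PR n (\<lambda>xs. rec_nat (f xs) (\<lambda>k r. r - Suc 0) (g xs))"
    by (intro pr) auto
  moreover have "rec_nat a (\<lambda>k r. r - Suc 0) m = a - m" for a m :: nat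
    by (induction m) auto
  ultimately show ?thesis by simp
qed

lemma PR_sum [pr]:
  assumes "PR (Suc n) (\<lambda>ys. g (ys ! 0) (tl ys))" "PR n b"
  shows "PR n (\<lambda>xs. \<Sum>k<b xs. g k xs)"
proof -
  have "PR (Suc (Suc n)) (\<lambda>ys. g (ys ! 0) (tl (tl ys)))"
  proof -
    from assms(1) obtain s where s: "wf_fsym s" "arity s = Suc n"
      "\<forall>ys. length ys = Suc n \<longrightarrow> fsym_val s ys = g (ys ! 0) (tl ys)"
      unfolding PR_def by blast
    let ?gs = "Proj (Suc (Suc n)) 0 # map (Proj (Suc (Suc n))) [2..<Suc (Suc n)]"
    have *: "map (\<lambda>f. fsym_val f ys) ?gs = ys ! 0 # tl (tl ys)"
      if "length ys = Suc (Suc n)" for ys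
      using that by (intro nth_equalityI) (auto simp: nth_Cons nth_tl simp del: upt_Suc split: nat.splits)
    have "wf_fsym (Comp (Suc (Suc n)) s ?gs)"
      using s by (auto simp del: upt_Suc)
    moreover have "fsym_val (Comp (Suc (Suc n)) s ?gs) ys = g (ys ! 0) (tl (tl ys))"
      if "length ys = Suc (Suc n)" for ys
      unfolding fsym_val.simps *[OF that] using s(3) that by simp
    ultimately show ?thesis
      unfolding PR_def by (metis arity.simps(4))
  qed
  then have "PR n (\<lambda>xs. rec_nat 0 (\<lambda>k r. r + g k xs) (b xs))"
    using assms by (intro pr) auto
  moreover have "rec_nat 0 (\<lambda>k r. r + g k xs) m = (\<Sum>k<m. g k xs)" for m xs
    by (induction m) auto
  ultimately show ?thesis by simp
qed

lemma PR_mult [pr]: "PR n f \<Longrightarrow> PR n g \<Longrightarrow> PR n (\<lambda>xs. f xs * g xs)"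
proof -
  assume f: "PR n f" and g: "PR n g"
  have "PR (Suc n) (\<lambda>ys. f (tl ys))"
  proof -
    from f obtain s where s: "wf_fsym s" "arity s = n"
      "\<forall>ys. length ys = n \<longrightarrow> fsym_val s ys = f ys"
      unfolding PR_def by blast
    have *: "map (\<lambda>f. fsym_val f ys) (map (Proj (Suc n)) [1..<Suc n]) = tl ys"
      if "length ys = Suc n" for ys
      using that by (intro nth_equalityI) (auto simp: nth_tl simp del: upt_Suc)
    have "wf_fsym (Comp (Suc n) s (map (Proj (Suc n)) [1..<Suc n]))"
      using s by (auto simp del: upt_Suc)
    moreover have "fsym_val (Comp (Suc n) s (map (Proj (Suc n)) [1..<Suc n])) ys = f (tl ys)"
      if "length ys = Suc n" for ys
      unfolding fsym_val.simps *[OF that] using s(3) that by simp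
    ultimately show ?thesis
      unfolding PR_def by (metis arity.simps(4))
  qed
  then have "PR n (\<lambda>xs. \<Sum>k<g xs. f xs)"
    using g by (rule PR_sum)
  then show ?thesis by (simp add: mult.commute)
qed

lemma PR_not [pr]: "PR n (\<lambda>xs. of_bool (P xs)) \<Longrightarrow> PR n (\<lambda>xs. of_bool (\<not> P xs))"
proof -
  assume "PR n (\<lambda>xs. of_bool (P xs))"
  then have "PR n (\<lambda>xs. 1 - of_bool (P xs))" by (intro pr)
  then show ?thesis by (rule PR_cong) auto
qed

lemma PR_eq [pr]: "PR n f \<Longrightarrow> PR n g \<Longrightarrow> PR n (\<lambda>xs. of_bool (f xs = g xs))"
proof -
  assume "PR n f" "PR n g"
  then have "PR n (\<lambda>xs. 1 - ((f xs - g xs) + (g xs - f xs)))" by (intro pr)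
  then show ?thesis by (rule PR_cong) auto
qed

lemma PR_less [pr]: "PR n f \<Longrightarrow> PR n g \<Longrightarrow> PR n (\<lambda>xs. of_bool (f xs < g xs))"
proof -
  assume "PR n f" "PR n g"
  then have "PR n (\<lambda>xs. 1 - (Suc (f xs) - g xs))" by (intro pr)
  then show ?thesis by (rule PR_cong) auto
qed

lemma PR_conj [pr]: "PR n (\<lambda>xs. of_bool (P xs)) \<Longrightarrow> PR n (\<lambda>xs. of_bool (Q xs)) \<Longrightarrow>
  PR n (\<lambda>xs. of_bool (P xs \<and> Q xs))"
proof -
  assume "PR n (\<lambda>xs. of_bool (P xs))" "PR n (\<lambda>xs. of_bool (Q xs))"
  then have "PR n (\<lambda>xs. of_bool (P xs) * of_bool (Q xs))" by (rule PR_mult)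
  then show ?thesis by (rule PR_cong) auto
qed

lemma PR_imp [pr]: "PR n (\<lambda>xs. of_bool (P xs)) \<Longrightarrow> PR n (\<lambda>xs. of_bool (Q xs)) \<Longrightarrow>
  PR n (\<lambda>xs. of_bool (P xs \<longrightarrow> Q xs))"
proof -
  assume "PR n (\<lambda>xs. of_bool (P xs))" "PR n (\<lambda>xs. of_bool (Q xs))"
  then have "PR n (\<lambda>xs. of_bool (\<not> (P xs \<and> \<not> Q xs)))" by (intro pr)
  then show ?thesis by (rule PR_cong) auto
qed

lemma PR_if [pr]: "PR n (\<lambda>xs. of_bool (P xs)) \<Longrightarrow> PR n f \<Longrightarrow> PR n g \<Longrightarrow>
  PR n (\<lambda>xs. if P xs then f xs else g xs)"
proof -
  assume "PR n (\<lambda>xs. of_bool (P xs))" "PR n f" "PR n g"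
  then have "PR n (\<lambda>xs. of_bool (P xs) * f xs + (1 - of_bool (P xs)) * g xs)" by (intro pr)
  then show ?thesis by (rule PR_cong) auto
qed

lemma PR_all [pr]:
  assumes "PR (Suc n) (\<lambda>ys. of_bool (P (ys ! 0) (tl ys)))" "PR n b"
  shows "PR n (\<lambda>xs. of_bool (\<forall>k<b xs. P k xs))"
proof -
  have "PR n (\<lambda>xs. of_bool ((\<Sum>k<b xs. of_bool (\<not> P k xs)) = (0::nat)))"
    using assms by (intro pr)
  then show ?thesis by (rule PR_cong) auto
qed

lemma PR_prod_encode [pr]: "PR n f \<Longrightarrow> PR n g \<Longrightarrow> PR n (\<lambda>xs. prod_encode (f xs, g xs))"
proof -
  assume "PR n f" "PR n g"
  then have "PR n (\<lambda>xs. (\<Sum>k<Suc (f xs + g xs). k) + f xs)"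
    by (intro pr) auto
  moreover have "(\<Sum>k<Suc m. k) = triangle m" for m
    by (induction m) auto
  ultimately show ?thesis by (simp add: prod_encode_def)
qed

definition pfst :: "nat \<Rightarrow> nat" where "pfst z = fst (prod_decode z)"
definition psnd :: "nat \<Rightarrow> nat" where "psnd z = snd (prod_decode z)"

lemma pfst_psnd [simp]: "pfst (prod_encode (a, b)) = a" "psnd (prod_encode (a, b)) = b"
  by (simp_all add: pfst_def psnd_def)

lemma prod_encode_pfst_psnd [simp]: "prod_encode (pfst z, psnd z) = z"
  by (simp add: pfst_def psnd_def)

lemma pfst_le: "pfst z \<le> z" and psnd_le: "psnd z \<le> z"
  using le_prod_encode_1[of "pfst z" "psnd z"] le_prod_encode_2[of "psnd z" "pfst z"] by simp_all

lemma prod_search: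
  "(\<Sum>x<Suc z. \<Sum>y<Suc z. of_bool (prod_encode (x, y) = z) * h x y) = (h (pfst z) (psnd z) :: nat)"
proof -
  have "(\<Sum>x<Suc z. \<Sum>y<Suc z. of_bool (prod_encode (x, y) = z) * h x y) =
    (\<Sum>p\<in>{..<Suc z} \<times> {..<Suc z}. of_bool (prod_encode p = z) * h (fst p) (snd p))"
    unfolding sum.cartesian_product by (simp only: split_def prod.collapse)
  also have "\<dots> = (\<Sum>p\<in>{(pfst z, psnd z)}. of_bool (prod_encode p = z) * h (fst p) (snd p))"
  proof (rule sum.mono_neutral_right)
    show "{(pfst z, psnd z)} \<subseteq> {..<Suc z} \<times> {..<Suc z}"
      using pfst_le[of z] psnd_le[of z] by auto
  qed auto
  finally show ?thesis by simp
qed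

lemma PR_comp1:
  assumes "PR 1 (\<lambda>xs. h (xs ! 0))" "PR n f"
  shows "PR n (\<lambda>xs. h (f xs))"
proof -
  from assms obtain s t where "wf_fsym s" "arity s = 1"
    "\<forall>xs. length xs = 1 \<longrightarrow> fsym_val s xs = h (xs ! 0)"
    "wf_fsym t" "arity t = n" "\<forall>xs. length xs = n \<longrightarrow> fsym_val t xs = f xs"
    unfolding PR_def by blast
  then show ?thesis unfolding PR_def by (intro exI[of _ "Comp n s [t]"]) auto
qed

lemma PR_comp3:
  assumes "PR 3 (\<lambda>xs. h (xs ! 0) (xs ! 1) (xs ! 2))" "PR n f1" "PR n f2" "PR n f3"
  shows "PR n (\<lambda>xs. h (f1 xs) (f2 xs) (f3 xs))"
proof -
  from assms(1) obtain s where s: "wf_fsym s" "arity s = 3"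
    "\<forall>xs. length xs = 3 \<longrightarrow> fsym_val s xs = h (xs ! 0) (xs ! 1) (xs ! 2)"
    unfolding PR_def by blast
  from assms(2-4) obtain t1 t2 t3 where t:
    "wf_fsym t1" "arity t1 = n" "\<forall>xs. length xs = n \<longrightarrow> fsym_val t1 xs = f1 xs"
    "wf_fsym t2" "arity t2 = n" "\<forall>xs. length xs = n \<longrightarrow> fsym_val t2 xs = f2 xs"
    "wf_fsym t3" "arity t3 = n" "\<forall>xs. length xs = n \<longrightarrow> fsym_val t3 xs = f3 xs"
    unfolding PR_def by blast
  show ?thesis unfolding PR_def
    using s t by (intro exI[of _ "Comp n s [t1, t2, t3]"]) auto
qed

lemma PR_pfst [pr]: "PR n f \<Longrightarrow> PR n (\<lambda>xs. pfst (f xs))"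
proof -
  have "PR 1 (\<lambda>xs. \<Sum>x<Suc (xs ! 0). \<Sum>y<Suc (xs ! 0). of_bool (prod_encode (x, y) = xs ! 0) * x)"
    by (intro pr) auto
  then have "PR 1 (\<lambda>xs. pfst (xs ! 0))" by (simp only: prod_search)
  then show "PR n f \<Longrightarrow> PR n (\<lambda>xs. pfst (f xs))" by (rule PR_comp1[of pfst])
qed

lemma PR_psnd [pr]: "PR n f \<Longrightarrow> PR n (\<lambda>xs. psnd (f xs))"
proof -
  have "PR 1 (\<lambda>xs. \<Sum>x<Suc (xs ! 0). \<Sum>y<Suc (xs ! 0). of_bool (prod_encode (x, y) = xs ! 0) * y)"
    by (intro pr) auto
  then have "PR 1 (\<lambda>xs. psnd (xs ! 0))" by (simp only: prod_search)
  then show "PR n f \<Longrightarrow> PR n (\<lambda>xs. psnd (f xs))" by (rule PR_comp1[of psnd])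
qed

definition ltls :: "nat \<Rightarrow> nat \<Rightarrow> nat" where
  "ltls c k = rec_nat c (\<lambda>_ r. psnd (r - Suc 0)) k"
definition lnth :: "nat \<Rightarrow> nat \<Rightarrow> nat" where
  "lnth c k = pfst (ltls c k - Suc 0)"
definition llen :: "nat \<Rightarrow> nat" where
  "llen c = (\<Sum>k<c. of_bool (ltls c k \<noteq> 0))"

lemma PR_ltls [pr]: "PR n f \<Longrightarrow> PR n g \<Longrightarrow> PR n (\<lambda>xs. ltls (f xs) (g xs))"
  unfolding ltls_def by (intro pr) auto

lemma PR_lnth [pr]: "PR n f \<Longrightarrow> PR n g \<Longrightarrow> PR n (\<lambda>xs. lnth (f xs) (g xs))"
  unfolding lnth_def by (intro pr)

lemma PR_llen [pr]: "PR n f \<Longrightarrow> PR n (\<lambda>xs. llen (f xs))"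
proof -
  have "PR 1 (\<lambda>xs. llen (xs ! 0))" unfolding llen_def by (intro pr) auto
  then show "PR n f \<Longrightarrow> PR n (\<lambda>xs. llen (f xs))" by (rule PR_comp1[of llen])
qed

lemma psnd_0 [simp]: "psnd 0 = 0"
  using psnd_le[of 0] by simp

lemma ltls_list_encode: "ltls (list_encode xs) k = list_encode (drop k xs)"
proof (induction k)
  case 0
  show ?case by (simp add: ltls_def)
next
  case (Suc k)
  have "ltls (list_encode xs) (Suc k) = psnd (ltls (list_encode xs) k - Suc 0)"
    by (simp add: ltls_def)
  also have "\<dots> = list_encode (tl (drop k xs))"
    unfolding Suc by (cases "drop k xs") auto
  finally show ?case by (simp add: drop_Suc tl_drop)
qed

lemma lnth_list_encode: "k < length xs \<Longrightarrow> lnth (list_encode xs) k = xs ! k"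
  by (simp add: lnth_def ltls_list_encode Cons_nth_drop_Suc[symmetric])

lemma list_encode_eq_0: "list_encode xs = 0 \<longleftrightarrow> xs = []"
  by (cases xs) auto

lemma length_le_list_encode: "length xs \<le> list_encode xs"
proof (induction xs)
  case (Cons x xs)
  then show ?case using le_prod_encode_2[of "list_encode xs" x] by simp
qed simp

lemma llen_list_encode: "llen (list_encode xs) = length xs"
proof -
  have "llen (list_encode xs) = (\<Sum>k<list_encode xs. of_bool (k < length xs))"
    by (simp add: llen_def ltls_list_encode list_encode_eq_0 not_le)
  also have "\<dots> = (\<Sum>k<length xs. 1)"
    using length_le_list_encode[of xs] by (intro sum.mono_neutral_cong_right) auto
  finally show ?thesis by simp
qed

lemma mem_list_encode_less: "x \<in> set xs \<Longrightarrow> x < list_encode xs"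
proof (induction xs)
  case (Cons y xs)
  then show ?case
    using le_prod_encode_1[of y "list_encode xs"] le_prod_encode_2[of "list_encode xs" y]
    by (auto simp: less_Suc_eq_le)
qed simp

lemma lnth_less: "k < llen c \<Longrightarrow> lnth c k < c"
  using llen_list_encode[of "list_decode c"] lnth_list_encode[of k "list_decode c"]
    mem_list_encode_less[of "list_decode c ! k" "list_decode c"] by simp

text \<open>Course-of-values recursion: \<open>hist G xs i\<close> codes the list of the values at
  \<open>i - 1, \<dots>, 0\<close>, and \<open>hget h i j\<close> reads off the value at \<open>j < i\<close>.\<close>

definition hist :: "(nat \<Rightarrow> nat \<Rightarrow> nat list \<Rightarrow> nat) \<Rightarrow> nat list \<Rightarrow> nat \<Rightarrow> nat" where
  "hist G xs i = rec_nat 0 (\<lambda>k r. Suc (prod_encode (G k r xs, r))) i"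
definition cov :: "(nat \<Rightarrow> nat \<Rightarrow> nat list \<Rightarrow> nat) \<Rightarrow> nat list \<Rightarrow> nat \<Rightarrow> nat" where
  "cov G xs i = lnth (hist G xs (Suc i)) 0"
definition hget :: "nat \<Rightarrow> nat \<Rightarrow> nat \<Rightarrow> nat" where
  "hget h i j = lnth h (i - Suc j)"

lemma PR_hget [pr]:
  "PR n f \<Longrightarrow> PR n g \<Longrightarrow> PR n h \<Longrightarrow> PR n (\<lambda>xs. hget (f xs) (g xs) (h xs))"
  unfolding hget_def by (intro pr)

lemma PR_cov [pr]:
  assumes "PR (Suc (Suc n)) (\<lambda>ys. G (ys ! 0) (ys ! 1) (tl (tl ys)))" "PR n a"
  shows "PR n (\<lambda>xs. cov G xs (a xs))"
  unfolding cov_def hist_def using assms by (intro pr) auto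

lemma cov_cong: "(\<And>i h. G i h xs = G i h ys) \<Longrightarrow> cov G xs i = cov G ys i"
  by (simp add: cov_def hist_def)

lemma cov_eq: "cov G xs i = G i (hist G xs i) xs"
  by (simp add: cov_def hist_def lnth_def ltls_def)

lemma hist_eq: "hist G xs i = list_encode (rev (map (cov G xs) [0..<i]))"
proof (induction i)
  case (Suc i)
  have "hist G xs (Suc i) = Suc (prod_encode (cov G xs i, hist G xs i))"
    unfolding cov_eq by (simp add: hist_def)
  then show ?case using Suc by simp
qed (simp add: hist_def)

lemma hget_hist: "j < i \<Longrightarrow> hget (hist G xs i) i j = cov G xs j"
  by (simp add: hget_def hist_eq lnth_list_encode rev_nth)

lemma less_prod_encode:
  "0 < t \<Longrightarrow> b < prod_encode (t, b)" for t b
  by (cases t) (auto simp: prod_encode_def)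

lemma psnd_less: "0 < pfst i \<Longrightarrow> psnd i < i"
  using less_prod_encode[of "pfst i" "psnd i"] by simp

lemma pfst_psnd_less:
  assumes "0 < pfst i"
  shows "pfst (psnd i) < i" "psnd (psnd i) < i" "pfst (psnd (psnd i)) < i" "psnd (psnd (psnd i)) < i"
  using psnd_less[OF assms] pfst_le psnd_le le_less_trans order_trans by metis+

lemma llen_lnth_all:
  "(\<forall>k<length ls. P (lnth (list_encode ls) k)) \<longleftrightarrow> (\<forall>x\<in>set ls. P x)"
  "(\<forall>k<length as. P (lnth (list_encode (map c as)) k)) \<longleftrightarrow> (\<forall>a\<in>set as. P (c a))"
  by (simp_all add: lnth_list_encode all_set_conv_all_nth)

lemma ex_map_list:
  "\<forall>x\<in>set ls. \<exists>a. P a \<and> c a = x \<Longrightarrow> \<exists>as. ls = map c as \<and> (\<forall>a\<in>set as. P a)"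
proof (induction ls)
  case (Cons x ls)
  then obtain as a where "ls = map c as" "\<forall>a\<in>set as. P a" "P a" "c a = x" by auto
  then show ?case by (intro exI[of _ "a # as"]) auto
qed simp

lemma ex_list_encode: "\<exists>ls. l = list_encode ls"
  using list_decode_inverse by metis

lemma ex_prod_encode: "\<exists>a b. i = prod_encode (a, b)"
  using prod_encode_pfst_psnd by metis

lemma prod_encode_0_iff: "prod_encode (a, b) = 0 \<longleftrightarrow> a = 0 \<and> b = 0"
  using prod_encode_eq[of "(a, b)" "(0, 0)"] by (simp add: prod_encode_def)

definition fsymG :: "nat \<Rightarrow> nat \<Rightarrow> nat list \<Rightarrow> nat" where
  "fsymG i h xs =
    (if i = 0 then 1
     else if pfst i = 1 \<and> psnd i = 0 then 2
     else if pfst i = 2 \<and> psnd (psnd i) < pfst (psnd i) then Suc (pfst (psnd i))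
     else if pfst i = 3 \<and> hget h i (pfst (psnd (psnd i))) = Suc (llen (psnd (psnd (psnd i)))) \<and>
       (\<forall>k<llen (psnd (psnd (psnd i))).
          hget h i (lnth (psnd (psnd (psnd i))) k) = Suc (pfst (psnd i)))
       then Suc (pfst (psnd i))
     else if pfst i = 4 \<and> \<not> hget h i (pfst (psnd i)) = 0 \<and>
       hget h i (psnd (psnd i)) = Suc (Suc (hget h i (pfst (psnd i))))
       then Suc (hget h i (pfst (psnd i)))
     else 0)"

definition fsymN :: "nat \<Rightarrow> nat" where
  "fsymN i = cov fsymG [] i"

lemma PR_fsymN [pr]: "PR n f \<Longrightarrow> PR n (\<lambda>xs. fsymN (f xs))"
proof (rule PR_comp1[of fsymN])
  have "PR 1 (\<lambda>xs. cov fsymG xs (xs ! 0))"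
    unfolding fsymG_def by (intro pr) auto
  then show "PR 1 (\<lambda>xs. fsymN (xs ! 0))"
    by (simp add: fsymN_def cov_def hist_def fsymG_def)
qed

lemma fsymN_eq:
  "fsymN i =
    (if i = 0 then 1
     else if pfst i = 1 \<and> psnd i = 0 then 2
     else if pfst i = 2 \<and> psnd (psnd i) < pfst (psnd i) then Suc (pfst (psnd i))
     else if pfst i = 3 \<and> fsymN (pfst (psnd (psnd i))) = Suc (llen (psnd (psnd (psnd i)))) \<and>
       (\<forall>k<llen (psnd (psnd (psnd i))).
          fsymN (lnth (psnd (psnd (psnd i))) k) = Suc (pfst (psnd i)))
       then Suc (pfst (psnd i))
     else if pfst i = 4 \<and> \<not> fsymN (pfst (psnd i)) = 0 \<and>
       fsymN (psnd (psnd i)) = Suc (Suc (fsymN (pfst (psnd i))))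
       then Suc (fsymN (pfst (psnd i)))
     else 0)"
proof -
  have "lnth (psnd (psnd (psnd i))) k < i" if "pfst i = 3" "k < llen (psnd (psnd (psnd i)))" for k
    using lnth_less[OF that(2)] pfst_psnd_less(4)[of i] that(1) by simp
  then show ?thesis
    unfolding fsymN_def
    by (subst cov_eq, subst fsymG_def) (simp add: hget_hist pfst_psnd_less cong: conj_cong)
qed

lemma fsymN_code: "wf_fsym s \<Longrightarrow> fsymN (code_fsym s) = Suc (arity s)"
proof (induction s)
  case (Comp n f gs)
  then show ?case
    by (subst fsymN_eq) (simp add: prod_encode_0_iff llen_lnth_all[where P = "\<lambda>x. fsymN x = c" for c] llen_list_encode)
qed (subst fsymN_eq, simp add: prod_encode_0_iff)+

lemma fsymN_D: "fsymN i = Suc n \<Longrightarrow> \<exists>s. wf_fsym s \<and> arity s = n \<and> code_fsym s = i"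
proof (induction i arbitrary: n rule: less_induct)
  case (less i)
  consider "i = 0" "n = 0" | "i = prod_encode (1, 0)" "n = 1"
    | k where "i = prod_encode (2, prod_encode (n, k))" "k < n"
    | f ls where "i = prod_encode (3, prod_encode (n, prod_encode (f, list_encode ls)))"
        "fsymN f = Suc (length ls)" "\<forall>x\<in>set ls. fsymN x = Suc n"
    | f g where "i = prod_encode (4, prod_encode (f, g))" "fsymN f \<noteq> 0"
        "fsymN g = Suc (Suc (fsymN f))" "n = fsymN f"
  proof -
    obtain t y where i: "i = prod_encode (t, y)" using ex_prod_encode by blast
    obtain a b where y: "y = prod_encode (a, b)" using ex_prod_encode by blast
    obtain c l where b: "b = prod_encode (c, l)" using ex_prod_encode by blast
    obtain ls where l: "l = list_encode ls" using ex_list_encode by blast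
    show thesis
      using less.prems that unfolding i
      by (subst (asm) fsymN_eq)
        (auto simp: y b l llen_lnth_all[where P = "\<lambda>x. fsymN x = c" for c] llen_list_encode prod_encode_0_iff split: if_splits)
  qed
  then show ?case
  proof cases
    case 1
    then show ?thesis by (intro exI[of _ Zero]) (simp add: prod_encode_def)
  next
    case 2
    then show ?thesis by (intro exI[of _ Succ]) simp
  next
    case (3 k)
    then show ?thesis by (intro exI[of _ "Proj n k"]) simp
  next
    case (4 f ls)
    have "f < i" "list_encode ls < i"
      using pfst_psnd_less[of i] 4(1) by simp_all
    then obtain f' where f: "wf_fsym f'" "arity f' = length ls" "code_fsym f' = f"
      using less.IH 4(2) by blast
    have "\<forall>x\<in>set ls. \<exists>s. (wf_fsym s \<and> arity s = n) \<and> code_fsym s = x"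
      using less.IH 4(3) mem_list_encode_less \<open>list_encode ls < i\<close> order.strict_trans by (metis (full_types))
    from ex_map_list[OF this] obtain gs where
      "ls = map code_fsym gs" "\<forall>g\<in>set gs. wf_fsym g \<and> arity g = n" by blast
    then show ?thesis using f 4(1) by (intro exI[of _ "Comp n f' gs"]) simp
  next
    case (5 f g)
    have "f < i" "g < i" using pfst_psnd_less[of i] 5(1) by simp_all
    moreover obtain m where m: "fsymN f = Suc m" using 5(2) not0_implies_Suc by blast
    ultimately obtain f' g' where "wf_fsym f'" "arity f' = m" "code_fsym f' = f"
      "wf_fsym g'" "arity g' = Suc (Suc m)" "code_fsym g' = g"
      using less.IH[of f m] less.IH[of g "Suc (Suc m)"] 5(3) by auto
    then show ?thesis using 5 m by (intro exI[of _ "PRec f' g'"]) simp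
  qed
qed

definition tmG :: "nat \<Rightarrow> nat \<Rightarrow> nat list \<Rightarrow> nat" where
  "tmG i h xs =
    (if pfst i = 0 then 1
     else if pfst i = 1 \<and> fsymN (pfst (psnd i)) = Suc (llen (psnd (psnd i))) \<and>
       (\<forall>k<llen (psnd (psnd i)). hget h i (lnth (psnd (psnd i)) k) = 1) then 1
     else 0)"

definition tmN :: "nat \<Rightarrow> nat" where
  "tmN i = cov tmG [] i"

lemma PR_tmN [pr]: "PR n f \<Longrightarrow> PR n (\<lambda>xs. tmN (f xs))"
proof (rule PR_comp1[of tmN])
  have "PR 1 (\<lambda>xs. cov tmG xs (xs ! 0))"
    unfolding tmG_def by (intro pr) auto
  then show "PR 1 (\<lambda>xs. tmN (xs ! 0))"
    by (simp add: tmN_def cov_def hist_def tmG_def)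
qed

lemma tmN_eq:
  "tmN i =
    (if pfst i = 0 then 1
     else if pfst i = 1 \<and> fsymN (pfst (psnd i)) = Suc (llen (psnd (psnd i))) \<and>
       (\<forall>k<llen (psnd (psnd i)). tmN (lnth (psnd (psnd i)) k) = 1) then 1
     else 0)"
proof -
  have "lnth (psnd (psnd i)) k < i" if "pfst i = 1" "k < llen (psnd (psnd i))" for k
    using lnth_less[OF that(2)] pfst_psnd_less(2)[of i] that(1) by simp
  then show ?thesis
    unfolding tmN_def
    by (subst cov_eq, subst tmG_def) (simp add: hget_hist pfst_psnd_less cong: conj_cong)
qed

lemma tmN_code: "wf_tm t \<Longrightarrow> tmN (code_tm t) = 1"
proof (induction t)
  case (Fn f ts)
  then show ?case
    by (subst tmN_eq) (simp add: llen_lnth_all[where P = "\<lambda>x. tmN x = c" for c] llen_list_encode fsymN_code)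
qed (subst tmN_eq, simp)

lemma tmN_iff:
  "tmN i = 1 \<longleftrightarrow> pfst i = 0 \<or> pfst i = 1 \<and>
     fsymN (pfst (psnd i)) = Suc (llen (psnd (psnd i))) \<and>
     (\<forall>k<llen (psnd (psnd i)). tmN (lnth (psnd (psnd i)) k) = 1)"
  by (subst tmN_eq) simp

lemma tmN_D: "tmN i = 1 \<Longrightarrow> \<exists>t. wf_tm t \<and> code_tm t = i"
proof (induction i rule: less_induct)
  case (less i)
  consider x where "i = prod_encode (0, x)"
    | f ls where "i = prod_encode (1, prod_encode (f, list_encode ls))"
        "fsymN f = Suc (length ls)" "\<forall>x\<in>set ls. tmN x = 1"
  proof -
    obtain t y where i: "i = prod_encode (t, y)" using ex_prod_encode by blast
    obtain a l where y: "y = prod_encode (a, l)" using ex_prod_encode by blast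
    obtain ls where l: "l = list_encode ls" using ex_list_encode by blast
    have "t = 0 \<or> (t = 1 \<and> fsymN a = Suc (length ls) \<and> (\<forall>x\<in>set ls. tmN x = 1))"
      using less.prems[unfolded tmN_iff[of i]]
      by (simp only: i y l pfst_psnd llen_list_encode llen_lnth_all(1)[where P = "\<lambda>x. tmN x = 1"])
    then show thesis
      using that(1)[of y] that(2)[of a ls] unfolding i y l by blast
  qed
  then show ?case
  proof cases
    case (1 x)
    then show ?thesis by (intro exI[of _ "Var x"]) simp
  next
    case (2 f ls)
    have "list_encode ls < i"
      using pfst_psnd_less[of i] 2(1) by simp
    from fsymN_D[OF 2(2)] obtain f' where f: "wf_fsym f'" "arity f' = length ls" "code_fsym f' = f"
      by blast
    have "\<forall>x\<in>set ls. \<exists>t. wf_tm t \<and> code_tm t = x"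
    proof
      fix x assume x: "x \<in> set ls"
      have "x < i" using mem_list_encode_less[OF x] \<open>list_encode ls < i\<close> by simp
      then show "\<exists>t. wf_tm t \<and> code_tm t = x" using less.IH 2(3) x by blast
    qed
    from ex_map_list[OF this] obtain ts where
      "ls = map code_tm ts" "\<forall>t\<in>set ts. wf_tm t" by blast
    then show ?thesis using f 2(1) by (intro exI[of _ "Fn f' ts"]) simp
  qed
qed

definition fmG :: "nat \<Rightarrow> nat \<Rightarrow> nat list \<Rightarrow> nat" where
  "fmG i h xs =
    (if i = 0 then 1
     else if pfst i = 1 \<and> tmN (pfst (psnd i)) = 1 \<and> tmN (psnd (psnd i)) = 1 then 1
     else if pfst i = 2 \<and> hget h i (pfst (psnd i)) = 1 \<and> hget h i (psnd (psnd i)) = 1 then 1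
     else if pfst i = 3 \<and> hget h i (psnd (psnd i)) = 1 then 1
     else 0)"

definition fmN :: "nat \<Rightarrow> nat" where
  "fmN i = cov fmG [] i"

lemma PR_fmN [pr]: "PR n f \<Longrightarrow> PR n (\<lambda>xs. fmN (f xs))"
proof (rule PR_comp1[of fmN])
  have "PR 1 (\<lambda>xs. cov fmG xs (xs ! 0))"
    unfolding fmG_def by (intro pr) auto
  then show "PR 1 (\<lambda>xs. fmN (xs ! 0))"
    by (simp add: fmN_def cov_def hist_def fmG_def)
qed

lemma fmN_eq:
  "fmN i =
    (if i = 0 then 1
     else if pfst i = 1 \<and> tmN (pfst (psnd i)) = 1 \<and> tmN (psnd (psnd i)) = 1 then 1
     else if pfst i = 2 \<and> fmN (pfst (psnd i)) = 1 \<and> fmN (psnd (psnd i)) = 1 then 1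
     else if pfst i = 3 \<and> fmN (psnd (psnd i)) = 1 then 1
     else 0)"
  unfolding fmN_def
  by (subst cov_eq, subst fmG_def) (simp add: hget_hist pfst_psnd_less cong: conj_cong)

lemma fmN_code: "wf_fm p \<Longrightarrow> fmN (gnum p) = 1"
  by (induction p) (subst fmN_eq, simp add: prod_encode_0_iff tmN_code)+

lemma fmN_iff:
  "fmN i = 1 \<longleftrightarrow> i = 0 \<or>
     pfst i = 1 \<and> tmN (pfst (psnd i)) = 1 \<and> tmN (psnd (psnd i)) = 1 \<or>
     pfst i = 2 \<and> fmN (pfst (psnd i)) = 1 \<and> fmN (psnd (psnd i)) = 1 \<or>
     pfst i = 3 \<and> fmN (psnd (psnd i)) = 1"
  by (subst fmN_eq) auto

lemma fmN_D: "fmN i = 1 \<Longrightarrow> \<exists>p. wf_fm p \<and> gnum p = i"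
proof (induction i rule: less_induct)
  case (less i)
  consider "i = 0"
    | a b where "i = prod_encode (1, prod_encode (a, b))" "tmN a = 1" "tmN b = 1"
    | a b where "i = prod_encode (2, prod_encode (a, b))" "fmN a = 1" "fmN b = 1"
    | a b where "i = prod_encode (3, prod_encode (a, b))" "fmN b = 1"
  proof -
    obtain t y where i: "i = prod_encode (t, y)" using ex_prod_encode by blast
    obtain a b where y: "y = prod_encode (a, b)" using ex_prod_encode by blast
    show thesis
      using less.prems[unfolded fmN_iff[of i]] that
      unfolding i y pfst_psnd by blast
  qed
  then show ?case
  proof cases
    case 1
    then show ?thesis by (intro exI[of _ Bot]) (simp add: prod_encode_def)
  next
    case (2 a b)
    from tmN_D[OF 2(2)] tmN_D[OF 2(3)] obtain s t
      where "wf_tm s" "code_tm s = a" "wf_tm t" "code_tm t = b" by blast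
    then show ?thesis using 2(1) by (intro exI[of _ "Eq s t"]) simp
  next
    case (3 a b)
    have "a < i" "b < i" using pfst_psnd_less[of i] 3(1) by simp_all
    then obtain p q where "wf_fm p" "gnum p = a" "wf_fm q" "gnum q = b"
      using less.IH 3 by blast
    then show ?thesis using 3(1) by (intro exI[of _ "Imp p q"]) simp
  next
    case (4 a b)
    have "b < i" using pfst_psnd_less[of i] 4(1) by simp
    then obtain p where "wf_fm p" "gnum p = b" using less.IH 4 by blast
    then show ?thesis using 4(1) by (intro exI[of _ "All a p"]) simp
  qed
qed

lemma rec_nat_map:
  "rec_nat 0 (\<lambda>k r. Suc (prod_encode (F (lnth (list_encode ls) (length ls - Suc k)), r))) (length ls)
    = list_encode (map F ls)"
proof -
  have "rec_nat 0 (\<lambda>k r. Suc (prod_encode (F (lnth (list_encode ls) (length ls - Suc k)), r))) m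
    = list_encode (map F (drop (length ls - m) ls))" if "m \<le> length ls" for m
    using that
  proof (induction m)
    case (Suc m)
    have "drop (length ls - Suc m) ls = ls ! (length ls - Suc m) # drop (length ls - m) ls"
      using Suc.prems Cons_nth_drop_Suc[of "length ls - Suc m" ls] by (simp add: Suc_diff_Suc)
    then show ?case using Suc by (simp add: lnth_list_encode)
  qed simp
  from this[of "length ls"] show ?thesis by simp
qed

definition tsubG :: "nat \<Rightarrow> nat \<Rightarrow> nat list \<Rightarrow> nat" where
  "tsubG i h xs =
    (if pfst i = 0 then (if psnd i = xs ! 0 then xs ! 1 else i)
     else prod_encode (1, prod_encode (pfst (psnd i),
       rec_nat 0 (\<lambda>k r. Suc (prod_encode
         (hget h i (lnth (psnd (psnd i)) (llen (psnd (psnd i)) - Suc k)), r)))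
         (llen (psnd (psnd i))))))"

definition tsubN :: "nat \<Rightarrow> nat \<Rightarrow> nat \<Rightarrow> nat" where
  "tsubN x u i = cov tsubG [x, u] i"

lemma PR_tsubN [pr]:
  "PR n f \<Longrightarrow> PR n g \<Longrightarrow> PR n h \<Longrightarrow> PR n (\<lambda>xs. tsubN (f xs) (g xs) (h xs))"
proof (rule PR_comp3[of tsubN])
  have "PR 3 (\<lambda>xs. cov tsubG xs (xs ! 2))"
    unfolding tsubG_def by (intro pr) auto
  then show "PR 3 (\<lambda>xs. tsubN (xs ! 0) (xs ! 1) (xs ! 2))"
    unfolding tsubN_def by (rule PR_cong) (rule cov_cong, simp add: tsubG_def)
qed

lemma tsubN_code: "tsubN x (code_tm u) (code_tm t) = code_tm (subst_tm x u t)"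
proof (induction t)
  case (Var y)
  show ?case unfolding tsubN_def by (subst cov_eq, subst tsubG_def) simp
next
  case (Fn f ts)
  let ?i = "code_tm (Fn f ts)" and ?ls = "map code_tm ts"
  let ?F = "hget (hist tsubG [x, code_tm u] ?i) ?i"
  have "list_encode ?ls < ?i" using pfst_psnd_less(2)[of ?i] by simp
  then have "?F y = tsubN x (code_tm u) y" if "y \<in> set ?ls" for y
    unfolding tsubN_def by (intro hget_hist) (use mem_list_encode_less[OF that] in simp)
  then have *: "map ?F ?ls = map code_tm (map (subst_tm x u) ts)"
    using Fn.IH by simp
  have "tsubN x (code_tm u) ?i = prod_encode (1, prod_encode (code_fsym f, list_encode (map ?F ?ls)))"
    unfolding tsubN_def rec_nat_map[symmetric]
    by (subst cov_eq, subst tsubG_def) (simp add: llen_list_encode)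
  then show ?case unfolding * by simp
qed

definition fsubG :: "nat \<Rightarrow> nat \<Rightarrow> nat list \<Rightarrow> nat" where
  "fsubG i h xs =
    (if pfst i = 0 then i
     else if pfst i = 1 then prod_encode (1,
       prod_encode (tsubN (xs ! 0) (xs ! 1) (pfst (psnd i)), tsubN (xs ! 0) (xs ! 1) (psnd (psnd i))))
     else if pfst i = 2 then prod_encode (2,
       prod_encode (hget h i (pfst (psnd i)), hget h i (psnd (psnd i))))
     else prod_encode (3, prod_encode (pfst (psnd i),
       if pfst (psnd i) = xs ! 0 then psnd (psnd i) else hget h i (psnd (psnd i)))))"

definition fsubN :: "nat \<Rightarrow> nat \<Rightarrow> nat \<Rightarrow> nat" where
  "fsubN x u i = cov fsubG [x, u] i"

lemma PR_fsubN [pr]: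
  "PR n f \<Longrightarrow> PR n g \<Longrightarrow> PR n h \<Longrightarrow> PR n (\<lambda>xs. fsubN (f xs) (g xs) (h xs))"
proof (rule PR_comp3[of fsubN])
  have "PR 3 (\<lambda>xs. cov fsubG xs (xs ! 2))"
    unfolding fsubG_def by (intro pr) auto
  then show "PR 3 (\<lambda>xs. fsubN (xs ! 0) (xs ! 1) (xs ! 2))"
    unfolding fsubN_def by (rule PR_cong) (rule cov_cong, simp add: fsubG_def)
qed

lemma fsubN_code: "fsubN x (code_tm u) (gnum p) = gnum (subst x u p)"
proof (induction p)
  case Bot
  show ?case unfolding fsubN_def by (subst cov_eq, subst fsubG_def) simp
next
  case (Eq s t)
  show ?case unfolding fsubN_def by (subst cov_eq, subst fsubG_def) (simp add: tsubN_code)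
next
  case (Imp p q)
  have "gnum p < gnum (Imp p q)" "gnum q < gnum (Imp p q)"
    using pfst_psnd_less[of "gnum (Imp p q)"] by simp_all
  then show ?case using Imp unfolding fsubN_def
    by (subst cov_eq, subst fsubG_def) (simp add: hget_hist)
next
  case (All y p)
  have "gnum p < gnum (All y p)"
    using pfst_psnd_less[of "gnum (All y p)"] by simp
  then show ?case using All unfolding fsubN_def
    by (subst cov_eq, subst fsubG_def) (simp add: hget_hist)
qed

lemma subst_tm_eq_iff: "subst_tm x (Fn f []) t = t \<longleftrightarrow> x \<notin> vars_tm t"
proof (induction t)
  case (Fn g ts)
  then show ?case by (simp add: map_idI list_eq_iff_nth_eq all_set_conv_all_nth)
qed auto

lemma subst_eq_iff: "subst x (Fn f []) p = p \<longleftrightarrow> x \<notin> fv p"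
  by (induction p) (auto simp: subst_tm_eq_iff)

lemma vars_tm_le: "x \<in> vars_tm t \<Longrightarrow> x \<le> code_tm t"
proof (induction t)
  case (Var y)
  then show ?case using le_prod_encode_2[of y 0] by simp
next
  case (Fn f ts)
  then obtain t where t: "t \<in> set ts" "x \<le> code_tm t" by auto
  have "code_tm t < list_encode (map code_tm ts)" using t(1) by (simp add: mem_list_encode_less)
  moreover have "list_encode (map code_tm ts) < code_tm (Fn f ts)"
    using pfst_psnd_less(2)[of "code_tm (Fn f ts)"] by simp
  ultimately show ?case using t(2) by linarith
qed

lemma fv_le: "x \<in> fv p \<Longrightarrow> x \<le> gnum p"
proof (induction p)
  case (Eq s t)
  then show ?case
    using pfst_psnd_less[of "gnum (Eq s t)"] vars_tm_le[of x s] vars_tm_le[of x t] by auto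
next
  case (Imp p q)
  then show ?case using pfst_psnd_less[of "gnum (Imp p q)"] by auto
next
  case (All y p)
  then show ?case using pfst_psnd_less[of "gnum (All y p)"] by auto
qed simp

definition numN :: "nat \<Rightarrow> nat" where
  "numN i = rec_nat (code_tm (Fn Zero []))
     (\<lambda>k r. prod_encode (1, prod_encode (code_fsym Succ, Suc (prod_encode (r, 0))))) i"

lemma numN_eq: "numN i = code_tm (numeral_tm i)"
  by (induction i) (simp_all add: numN_def)

lemma Gamma_iff:
  "i \<in> Gamma v \<longleftrightarrow>
     fmN i = 1 \<and> (\<forall>x<Suc i. \<not> x = v \<longrightarrow> fsubN x (code_tm (Fn Zero [])) i = i)"
proof -
  have "fv p \<subseteq> {v} \<longleftrightarrow>
      (\<forall>x<Suc (gnum p). \<not> x = v \<longrightarrow> fsubN x (code_tm (Fn Zero [])) (gnum p) = gnum p)" for p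
  proof -
    have "gnum (subst x (Fn Zero []) p) = gnum p \<longleftrightarrow> x \<notin> fv p" for x
      using gnum_inj subst_eq_iff by metis
    then show ?thesis unfolding fsubN_code using fv_le[of _ p] by (auto simp: less_Suc_eq_le)
  qed
  note fv_iff = this
  show ?thesis
  proof
    assume "i \<in> Gamma v"
    then obtain p where p: "i = gnum p" "wf_fm p" "fv p \<subseteq> {v}"
      unfolding Gamma_def v_formula_def by blast
    show "fmN i = 1 \<and> (\<forall>x<Suc i. \<not> x = v \<longrightarrow> fsubN x (code_tm (Fn Zero [])) i = i)"
      using fmN_code[OF p(2)] p(3)[unfolded fv_iff] unfolding p(1) by blast
  next
    assume R: "fmN i = 1 \<and> (\<forall>x<Suc i. \<not> x = v \<longrightarrow> fsubN x (code_tm (Fn Zero [])) i = i)"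
    then obtain p where p: "wf_fm p" "gnum p = i" using fmN_D by blast
    then have "fv p \<subseteq> {v}" unfolding fv_iff using R by blast
    then show "i \<in> Gamma v" using p unfolding Gamma_def v_formula_def by blast
  qed
qed

lemma PR_diag: "PR 1 (\<lambda>xs. diag v (xs ! 0))"
proof -
  have "diag v i = (if fmN i = 1 \<and> (\<forall>x<Suc i. \<not> x = v \<longrightarrow> fsubN x (code_tm (Fn Zero [])) i = i)
    then fsubN v (numN i) i else 0)" for i
  proof (cases "i \<in> Gamma v")
    case True
    then obtain p where "v_formula v p" "gnum p = i" unfolding Gamma_def by blast
    then have "gnum (phi v i) = i" using phi_gnum[of v p] by simp
    then show ?thesis
      using True fsubN_code[of v "numeral_tm i" "phi v i"] unfolding Gamma_iff[symmetric]
      by (simp add: diag_def numN_eq)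
  next
    case False
    then show ?thesis unfolding Gamma_iff[symmetric] by (simp add: diag_def)
  qed
  then show ?thesis
    unfolding numN_def by (simp only:) (intro pr; simp)
qed

lemma diag_sym:
  "wf_fsym (diag_sym v)" "arity (diag_sym v) = 1" "fsym_val (diag_sym v) [i] = diag v i"
proof -
  from PR_diag[of v] obtain s where "wf_fsym s" "arity s = 1"
    "\<forall>xs. length xs = 1 \<longrightarrow> fsym_val s xs = diag v (xs ! 0)" unfolding PR_def by blast
  then have "\<exists>s. wf_fsym s \<and> arity s = 1 \<and> (\<forall>i. fsym_val s [i] = diag v i)"
    by (intro exI[of _ s]) simp
  from someI_ex[OF this]
  show "wf_fsym (diag_sym v)" "arity (diag_sym v) = 1" "fsym_val (diag_sym v) [i] = diag v i"
    unfolding diag_sym_def by blast+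
qed

end

theory Submission
  imports Defs
begin

text \<open>If \<open>T\<close> is arithmetically definable, then so is its set of theorems, by some
  \<open>v\<close>-formula \<open>\<phi>\<^sub>i\<close>. The predicate \<open>a\<^sub>i\<close> then means provability of
  \<open>J(X)\<close> in \<open>T\<close>, so soundness of \<open>T\<close> is the hypothesis of G1\<open>\<^sup>+\<close> for \<open>a\<^sub>i\<close>. As
  \<open>J(nS)\<close> is the negation of \<open>J(S)\<close>, the string \<open>S\<close> obtained from G1\<open>\<^sup>+\<close> yields the
  undecided sentence \<open>J(S)\<close>.\<close>

section \<open>Arithmetical relations\<close>

text \<open>Relations are taken on whole assignments: variables serve as named arguments and
  quantification becomes an update, so free variables need no bookkeeping until a
  \<open>v\<close>-formula is extracted.\<close>

definition arithmetical :: "((nat \<Rightarrow> nat) \<Rightarrow> bool) \<Rightarrow> bool" where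
  "arithmetical P \<longleftrightarrow> (\<exists>p. wf_fm p \<and> (\<forall>e. sat e p \<longleftrightarrow> P e))"

lemma arithmetical_imp:
  assumes "arithmetical P" "arithmetical Q"
  shows "arithmetical (\<lambda>e. P e \<longrightarrow> Q e)"
proof -
  from assms obtain p q where "wf_fm p" "\<forall>e. sat e p \<longleftrightarrow> P e" "wf_fm q" "\<forall>e. sat e q \<longleftrightarrow> Q e"
    unfolding arithmetical_def by blast
  then show ?thesis unfolding arithmetical_def by (intro exI[of _ "Imp p q"]) simp
qed

lemma arithmetical_False: "arithmetical (\<lambda>e. False)"
  unfolding arithmetical_def by (rule exI[of _ Bot]) simp

lemma arithmetical_not: "arithmetical P \<Longrightarrow> arithmetical (\<lambda>e. \<not> P e)"
  using arithmetical_imp[OF _ arithmetical_False] by simp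

lemma arithmetical_disj:
  "arithmetical P \<Longrightarrow> arithmetical Q \<Longrightarrow> arithmetical (\<lambda>e. P e \<or> Q e)"
  using arithmetical_imp[of "\<lambda>e. \<not> P e" Q] arithmetical_not[of P] by (simp add: disj_imp)

lemma arithmetical_conj:
  "arithmetical P \<Longrightarrow> arithmetical Q \<Longrightarrow> arithmetical (\<lambda>e. P e \<and> Q e)"
  using arithmetical_not[OF arithmetical_imp[of P "\<lambda>e. \<not> Q e"]] arithmetical_not[of Q] by simp

lemma arithmetical_all:
  assumes "arithmetical P"
  shows "arithmetical (\<lambda>e. \<forall>a. P (e(x := a)))"
proof -
  from assms obtain p where "wf_fm p" "\<forall>e. sat e p \<longleftrightarrow> P e"
    unfolding arithmetical_def by blast
  then show ?thesis unfolding arithmetical_def by (intro exI[of _ "All x p"]) simp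
qed

lemma arithmetical_ex:
  assumes "arithmetical P"
  shows "arithmetical (\<lambda>e. \<exists>a. P (e(x := a)))"
  using arithmetical_not[OF arithmetical_all[OF arithmetical_not[OF assms], of x]] by simp

text \<open>Every primitive recursive function has a symbol in the language; applied to the
  variables \<open>0\<close> to \<open>n - 1\<close>, it reads its k-th argument from variable
  k.\<close>

lemma PR_term:
  assumes "PR n f"
  obtains t where "wf_tm t" "vars_tm t \<subseteq> {..<n}" "\<And>e. tm_val e t = f (map e [0..<n])"
proof -
  from assms obtain s where s: "wf_fsym s" "arity s = n"
    "\<forall>xs. length xs = n \<longrightarrow> fsym_val s xs = f xs"
    unfolding PR_def by blast
  show thesis
    by (rule that[of "Fn s (map Var [0..<n])"]) (use s in \<open>auto simp: comp_def\<close>)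
qed

lemma arithmetical_PR:
  assumes "PR n (\<lambda>xs. of_bool (P xs))"
  shows "arithmetical (\<lambda>e. P (map e [0..<n]))"
proof -
  obtain t where t: "wf_tm t" "\<And>e. tm_val e t = of_bool (P (map e [0..<n]))"
    using PR_term[OF assms] by metis
  then show ?thesis unfolding arithmetical_def
    by (intro exI[of _ "Eq t (numeral_tm 1)"]) simp
qed

text \<open>Transfers a definable set, which comes with a variable of its own, to values computed
  from other variables.\<close>

lemma arithmetical_mem:
  assumes "definable_N A" "PR n f"
  shows "arithmetical (\<lambda>e. f (map e [0..<n]) \<in> A)"
proof -
  obtain p x where p: "wf_fm p" "\<And>n e. n \<in> A \<longleftrightarrow> sat (e(x := n)) p"
    using assms(1) unfolding definable_N_def by blast
  obtain t where t: "wf_tm t" "\<And>e. tm_val e t = f (map e [0..<n])"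
    using PR_term[OF assms(2)] by metis
  \<comment> \<open>The value of \<open>t\<close> depends only on variables below \<open>n\<close>,
    so \<open>m\<close> does not affect it. Nor does \<open>m\<close> affect the truth of
    \<open>p\<close>, which depends on the value of \<open>x\<close> alone.\<close>
  define m where "m = Suc (n + x)"
  have m: "m \<noteq> x" "m \<ge> n" by (auto simp: m_def)
  have "map (e(m := a)) [0..<n] = map e [0..<n]" for e :: "nat \<Rightarrow> nat" and a
    using m by auto
  \<comment> \<open>\<open>x\<close> may occur in \<open>t\<close>, hence the detour through the fresh variable \<open>m\<close>\<close>
  then show ?thesis unfolding arithmetical_def
    using p t m
    by (intro exI[of _ "All m (Imp (Eq (Var m) t) (All x (Imp (Eq (Var x) (Var m)) p)))"])
      auto
qed

text \<open>The given formula may have further free variables. Its truth does not depend on their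
  values, so quantifying them universally changes nothing.\<close>

lemma arithmetical_v_formula:
  assumes "arithmetical (\<lambda>e. e v \<in> A)"
  obtains p where "v_formula v p" "\<And>e. sat e p \<longleftrightarrow> e v \<in> A"
proof -
  obtain p where p: "wf_fm p" "\<And>e. sat e p \<longleftrightarrow> e v \<in> A"
    using assms unfolding arithmetical_def by blast
  have "finite (vars_tm t)" for t by (induction t) auto
  then have "finite (fv p)" by (induction p) auto
  then obtain xs where xs: "set xs = fv p - {v}" using finite_list by (metis finite_Diff)
  have "v \<notin> set xs \<Longrightarrow>
      wf_fm (foldr All xs p) \<and> fv (foldr All xs p) = fv p - set xs \<and>
      (\<forall>e. sat e (foldr All xs p) \<longleftrightarrow> e v \<in> A)" for xs
    by (induction xs) (use p in auto)
  with xs show thesis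
    by (intro that[of "foldr All xs p"]) (auto simp: v_formula_def)
qed

lemma definable_N_iff: "definable_N A \<longleftrightarrow> arithmetical (\<lambda>e. e v \<in> A)"
proof
  assume "definable_N A"
  \<comment> \<open>The projection onto coordinate \<open>v\<close> replaces the variable of the
    defining formula by \<open>v\<close>.\<close>
  from arithmetical_mem[OF this PR_nth[of v "Suc v"]]
  show "arithmetical (\<lambda>e. e v \<in> A)" by (simp del: upt_Suc add: numeral_2_eq_2)
next
  assume "arithmetical (\<lambda>e. e v \<in> A)"
  then obtain p where "v_formula v p" "\<And>e. sat e p \<longleftrightarrow> e v \<in> A"
    by (rule arithmetical_v_formula) blast
  then show "definable_N A"
    unfolding definable_N_def v_formula_def by (intro exI[of _ p] exI[of _ v]) auto
qed

lemma definable_N_Un: "definable_N A \<Longrightarrow> definable_N B \<Longrightarrow> definable_N (A \<union> B)"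
  unfolding definable_N_iff[of _ 0] using arithmetical_disj by fastforce

text \<open>Four witnesses suffice for the parameters of any logical axiom scheme. Variable 0
  carries the candidate, variables 1 to 4 the witnesses.\<close>

lemma definable_N_PR_ex4:
  assumes "PR 5 (\<lambda>xs. of_bool (P (xs ! 0) (xs ! 1) (xs ! 2) (xs ! 3) (xs ! 4)))"
  shows "definable_N {x. \<exists>a b c d. P x a b c d}"
proof -
  have "arithmetical (\<lambda>e. P (e 0) (e 1) (e 2) (e 3) (e 4))"
    using arithmetical_PR[OF assms] by (simp del: upt_Suc add: numeral_2_eq_2)
  from arithmetical_ex[OF arithmetical_ex[OF arithmetical_ex[OF
      arithmetical_ex[OF this, of 4], of 3], of 2], of 1]
  show ?thesis by (simp add: definable_N_iff[of _ 0])
qed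

lemma PR_disj [pr]: "PR n (\<lambda>xs. of_bool (P xs)) \<Longrightarrow> PR n (\<lambda>xs. of_bool (Q xs)) \<Longrightarrow>
  PR n (\<lambda>xs. of_bool (P xs \<or> Q xs))"
  using PR_imp[of n "\<lambda>xs. \<not> P xs" Q] PR_not[of n P] by (simp add: disj_imp)

lemma PR_ex [pr]:
  assumes "PR (Suc n) (\<lambda>ys. of_bool (P (ys ! 0) (tl ys)))" "PR n b"
  shows "PR n (\<lambda>xs. of_bool (\<exists>k<b xs. P k xs))"
  using PR_not[OF PR_all[of n "\<lambda>k xs. \<not> P k xs", OF PR_not[OF assms(1)] assms(2)]] by simp


section \<open>Inductively generated sets\<close>

text \<open>An abstract proof system on codes: \<open>A\<close> stands for axioms and hypotheses,
  \<open>R a b x\<close> for the inference of \<open>x\<close> from \<open>a\<close> and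
  \<open>b\<close>.\<close>

inductive_set gen_by :: "nat set \<Rightarrow> (nat \<Rightarrow> nat \<Rightarrow> nat \<Rightarrow> bool) \<Rightarrow> nat set" for A R where
  base: "x \<in> A \<Longrightarrow> x \<in> gen_by A R"
| step: "a \<in> gen_by A R \<Longrightarrow> b \<in> gen_by A R \<Longrightarrow> R a b x \<Longrightarrow> x \<in> gen_by A R"

text \<open>Derivations are listed with the conclusion first, because list codes are built by \<open>#\<close>.\<close>

fun derivation :: "nat set \<Rightarrow> (nat \<Rightarrow> nat \<Rightarrow> nat \<Rightarrow> bool) \<Rightarrow> nat list \<Rightarrow> bool" where
  "derivation A R [] = True"
| "derivation A R (x # xs) =
     ((x \<in> A \<or> (\<exists>a\<in>set xs. \<exists>b\<in>set xs. R a b x)) \<and> derivation A R xs)"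

lemma derivation_append:
  "derivation A R xs \<Longrightarrow> derivation A R ys \<Longrightarrow> derivation A R (xs @ ys)"
  by (induction xs) auto

lemma derivation_gen_by: "derivation A R xs \<Longrightarrow> set xs \<subseteq> gen_by A R"
  by (induction xs) (auto intro: gen_by.intros)

text \<open>Entries are justified by later ones, so derivations of two premises can be concatenated
  and the conclusion put in front.\<close>

lemma gen_by_iff: "x \<in> gen_by A R \<longleftrightarrow> (\<exists>xs. derivation A R (x # xs))"
proof
  show "x \<in> gen_by A R \<Longrightarrow> \<exists>xs. derivation A R (x # xs)"
  proof (induction rule: gen_by.induct)
    case (base x)
    then show ?case by (intro exI[of _ "[]"]) simp
  next
    case (step a b x)
    then obtain xs ys where "derivation A R (a # xs)" "derivation A R (b # ys)" by blast
    from derivation_append[OF this] show ?case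
      using step.hyps(3) by (intro exI[of _ "(a # xs) @ b # ys"]) auto
  qed
  show "\<exists>xs. derivation A R (x # xs) \<Longrightarrow> x \<in> gen_by A R"
    using derivation_gen_by by fastforce
qed

text \<open>In terms of indices, all quantifiers are bounded by the length; apart from membership in
  \<open>A\<close>, the condition is primitive recursive in the code of the list when
  \<open>R\<close> is.\<close>

lemma derivation_nth:
  "derivation A R xs \<longleftrightarrow> (\<forall>k<length xs. xs ! k \<in> A \<or>
     (\<exists>i<length xs. \<exists>j<length xs. k < i \<and> k < j \<and> R (xs ! i) (xs ! j) (xs ! k)))"
proof (induction xs)
  case (Cons x xs)
  have "(\<exists>a\<in>set xs. \<exists>b\<in>set xs. R a b x) \<longleftrightarrow>
      (\<exists>i<length xs. \<exists>j<length xs. R (xs ! i) (xs ! j) x)"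
    by (metis in_set_conv_nth)
  then show ?case by (simp add: Cons All_less_Suc2 Ex_less_Suc2)
qed simp

lemma ex_list_encode_iff: "(\<exists>xs. P (list_encode xs)) \<longleftrightarrow> (\<exists>c. P c)"
  using ex_list_encode by metis

text \<open>A number is generated iff some code of a derivation starts with it. Since
  \<open>A\<close> is only arithmetical, the quantifier over positions is one of the formula
  language, while the check of a single inference is primitive recursive.\<close>

lemma definable_N_gen_by:
  assumes "definable_N A" "PR 3 (\<lambda>xs. of_bool (R (xs ! 0) (xs ! 1) (xs ! 2)))"
  shows "definable_N (gen_by A R)"
proof -
  let ?step = "\<lambda>c k. \<exists>i<llen c. \<exists>j<llen c. k < i \<and> k < j \<and> R (lnth c i) (lnth c j) (lnth c k)"
  note [pr] = PR_comp3[where h = "\<lambda>a b c. of_bool (R a b c)", OF assms(2)]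
  \<comment> \<open>Variable 0 will carry the generated number, variable 1 the code of a derivation,
    variable 2 a position in it.\<close>
  have "PR 3 (\<lambda>xs. of_bool (?step (xs ! 1) (xs ! 2)))"
    by (intro pr) auto
  from arithmetical_PR[OF this]
  have step: "arithmetical (\<lambda>e. ?step (e 1) (e 2))" by (simp del: upt_Suc add: numeral_2_eq_2)
  have "PR 3 (\<lambda>xs. lnth (xs ! 1) (xs ! 2))" by (intro pr) auto
  from arithmetical_mem[OF assms(1) this]
  have mem: "arithmetical (\<lambda>e. lnth (e 1) (e 2) \<in> A)" by (simp del: upt_Suc add: numeral_2_eq_2)
  have "PR 3 (\<lambda>xs. of_bool (xs ! 2 < llen (xs ! 1)))" by (intro pr) auto
  from arithmetical_PR[OF this]
  have len: "arithmetical (\<lambda>e. e 2 < llen (e 1))" by (simp del: upt_Suc add: numeral_2_eq_2)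
  have "PR 2 (\<lambda>xs. of_bool (0 < llen (xs ! 1) \<and> lnth (xs ! 1) 0 = xs ! 0))" by (intro pr) auto
  from arithmetical_PR[OF this]
  have hd: "arithmetical (\<lambda>e. 0 < llen (e 1) \<and> lnth (e 1) 0 = e 0)" by (simp del: upt_Suc add: numeral_2_eq_2)
  have "x \<in> gen_by A R \<longleftrightarrow> (\<exists>c. (0 < llen c \<and> lnth c 0 = x) \<and>
      (\<forall>k. k < llen c \<longrightarrow> lnth c k \<in> A \<or> ?step c k))" for x
  proof -
    have "x \<in> gen_by A R \<longleftrightarrow> (\<exists>xs. (0 < length xs \<and> xs ! 0 = x) \<and> derivation A R xs)"
      unfolding gen_by_iff by (metis length_greater_0_conv list.exhaust list.distinct(1) nth_Cons_0)
    also have "\<dots> \<longleftrightarrow> (\<exists>xs. (0 < llen (list_encode xs) \<and> lnth (list_encode xs) 0 = x) \<and>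
      (\<forall>k. k < llen (list_encode xs) \<longrightarrow>
        lnth (list_encode xs) k \<in> A \<or> ?step (list_encode xs) k))"
      unfolding derivation_nth llen_list_encode
      \<comment> \<open>\<open>lnth\<close> is known to agree with \<open>!\<close> only below the
        length; the congruence rules make these bounds available.\<close>
      by (simp add: lnth_list_encode cong: conj_cong imp_cong)
    also have "\<dots> \<longleftrightarrow> (\<exists>c. (0 < llen c \<and> lnth c 0 = x) \<and>
      (\<forall>k. k < llen c \<longrightarrow> lnth c k \<in> A \<or> ?step c k))"
      by (rule ex_list_encode_iff)
    finally show ?thesis .
  qed
  then show ?thesis
    using arithmetical_ex[OF arithmetical_conj[OF hd arithmetical_all[OF
      arithmetical_imp[OF len arithmetical_disj[OF mem step]], of 2]], of 1]
    by (simp add: definable_N_iff[of _ 0])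
qed


section \<open>Arithmetization of provability\<close>

abbreviation "impN a b \<equiv> prod_encode (2, prod_encode (a, b))"
abbreviation "eqN a b \<equiv> prod_encode (1, prod_encode (a, b))"
abbreviation "allN x a \<equiv> prod_encode (3, prod_encode (x, a))"

lemma fmN_eq_1_iff: "fmN i = 1 \<longleftrightarrow> (\<exists>p. wf_fm p \<and> gnum p = i)"
  using fmN_D fmN_code by blast

lemma tmN_eq_1_iff: "tmN i = 1 \<longleftrightarrow> (\<exists>t. wf_tm t \<and> code_tm t = i)"
  using tmN_D tmN_code by blast

text \<open>Substituting a constant changes a formula exactly when the variable is free in it, so
  freshness becomes an equation between primitive recursive functions.\<close>

lemma not_in_fv_code: "fsubN x (code_tm (Fn Zero [])) (gnum p) = gnum p \<longleftrightarrow> x \<notin> fv p"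
  unfolding fsubN_code using gnum_inj subst_eq_iff by metis

lemma not_in_vars_tm_code: "tsubN x (code_tm (Fn Zero [])) (code_tm t) = code_tm t \<longleftrightarrow> x \<notin> vars_tm t"
  unfolding tsubN_code using code_tm_inj subst_tm_eq_iff by metis

text \<open>Course-of-values step for \<open>free_for\<close>: \<open>xs\<close> holds the code of
  the term and the variable; tags 2 and 3 belong to \<open>Imp\<close> and \<open>All\<close>. The
  default 1 serves \<open>Bot\<close> and \<open>Eq\<close>.\<close>

definition ffG :: "nat \<Rightarrow> nat \<Rightarrow> nat list \<Rightarrow> nat" where
  "ffG i h xs =
    (if pfst i = 2 then
       of_bool (hget h i (pfst (psnd i)) = 1 \<and> hget h i (psnd (psnd i)) = 1)
     else if pfst i = 3 then
       of_bool (fsubN (xs ! 1) (code_tm (Fn Zero [])) i = i \<or>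
         tsubN (pfst (psnd i)) (code_tm (Fn Zero [])) (xs ! 0) = xs ! 0 \<and>
         hget h i (psnd (psnd i)) = 1)
     else 1)"

definition ffN :: "nat \<Rightarrow> nat \<Rightarrow> nat \<Rightarrow> nat" where
  "ffN u x i = cov ffG [u, x] i"

lemma PR_ffN [pr]:
  "PR n f \<Longrightarrow> PR n g \<Longrightarrow> PR n h \<Longrightarrow> PR n (\<lambda>xs. ffN (f xs) (g xs) (h xs))"
proof (rule PR_comp3[of ffN])
  have "PR 3 (\<lambda>xs. cov ffG xs (xs ! 2))"
    unfolding ffG_def by (intro pr) auto
  then show "PR 3 (\<lambda>xs. ffN (xs ! 0) (xs ! 1) (xs ! 2))"
    unfolding ffN_def by (rule PR_cong) (rule cov_cong, simp add: ffG_def)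
qed

lemma ffN_code: "ffN (code_tm u) x (gnum p) = of_bool (free_for u x p)"
proof (induction p)
  case Bot
  show ?case unfolding ffN_def by (subst cov_eq, subst ffG_def) simp
next
  case (Eq s t)
  show ?case unfolding ffN_def by (subst cov_eq, subst ffG_def) simp
next
  case (Imp p q)
  have "gnum p < gnum (Imp p q)" "gnum q < gnum (Imp p q)"
    using pfst_psnd_less[of "gnum (Imp p q)"] by simp_all
  then show ?case using Imp unfolding ffN_def
    by (subst cov_eq, subst ffG_def) (simp add: hget_hist)
next
  case (All y p)
  have "gnum p < gnum (All y p)"
    using pfst_psnd_less[of "gnum (All y p)"] by simp
  then show ?case using All not_in_fv_code[of x "All y p"] not_in_vars_tm_code[of y u]
    unfolding ffN_def
    by (subst cov_eq, subst ffG_def) (simp add: hget_hist del: fv.simps)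
qed

text \<open>\<open>a, b, c, d\<close> are the codes of the parameters of a logical axiom with code \<open>i\<close>;
  \<open>0\<close> is the code of \<open>Bot\<close>.\<close>

definition axN :: "nat \<Rightarrow> nat \<Rightarrow> nat \<Rightarrow> nat \<Rightarrow> nat \<Rightarrow> bool" where
  "axN i a b c d \<longleftrightarrow>
     fmN a = 1 \<and> fmN b = 1 \<and> i = impN a (impN b a) \<or>
     fmN a = 1 \<and> fmN b = 1 \<and> fmN c = 1 \<and>
       i = impN (impN a (impN b c)) (impN (impN a b) (impN a c)) \<or>
     fmN a = 1 \<and> i = impN (impN (impN a 0) 0) a \<or>
     fmN a = 1 \<and> tmN b = 1 \<and> ffN b c a = 1 \<and> i = impN (allN c a) (fsubN c b a) \<or>
     fmN a = 1 \<and> fmN b = 1 \<and> fsubN c (code_tm (Fn Zero [])) a = a \<and>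
       i = impN (allN c (impN a b)) (impN a (allN c b)) \<or>
     tmN a = 1 \<and> i = eqN a a \<or>
     fmN a = 1 \<and> tmN b = 1 \<and> tmN c = 1 \<and> ffN b d a = 1 \<and> ffN c d a = 1 \<and>
       i = impN (eqN b c) (impN (fsubN d b a) (fsubN d c a))"

text \<open>Splits the axiom schemes off from \<open>proves\<close>, so that only modus ponens and
  generalization remain as rules.\<close>

inductive log_axiom :: "fm \<Rightarrow> bool" where
  "wf_fm p \<Longrightarrow> wf_fm q \<Longrightarrow> log_axiom (Imp p (Imp q p))"
| "wf_fm p \<Longrightarrow> wf_fm q \<Longrightarrow> wf_fm r \<Longrightarrow>
     log_axiom (Imp (Imp p (Imp q r)) (Imp (Imp p q) (Imp p r)))"
| "wf_fm p \<Longrightarrow> log_axiom (Imp (Neg (Neg p)) p)"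
| "wf_fm p \<Longrightarrow> wf_tm t \<Longrightarrow> free_for t x p \<Longrightarrow> log_axiom (Imp (All x p) (subst x t p))"
| "wf_fm p \<Longrightarrow> wf_fm q \<Longrightarrow> x \<notin> fv p \<Longrightarrow> log_axiom (Imp (All x (Imp p q)) (Imp p (All x q)))"
| "wf_tm t \<Longrightarrow> log_axiom (Eq t t)"
| "wf_fm p \<Longrightarrow> wf_tm s \<Longrightarrow> wf_tm t \<Longrightarrow> free_for s x p \<Longrightarrow> free_for t x p \<Longrightarrow>
     log_axiom (Imp (Eq s t) (Imp (subst x s p) (subst x t p)))"

lemma gnum_Bot: "gnum Bot = 0"
  by (simp add: prod_encode_def)

text \<open>Each scheme supplies the codes of its parameters, padded with 0; conversely the tests
  \<open>fmN\<close> and \<open>tmN\<close> decode them. Variables stand for themselves.\<close>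

lemma log_axiom_code: "(\<exists>p. log_axiom p \<and> gnum p = i) \<longleftrightarrow> (\<exists>a b c d. axN i a b c d)"
proof
  assume "\<exists>p. log_axiom p \<and> gnum p = i"
  then obtain p where "log_axiom p" and i: "i = gnum p" by blast
  then show "\<exists>a b c d. axN i a b c d"
  proof cases
    case (1 p q)
    then have "axN i (gnum p) (gnum q) 0 0" by (auto simp: axN_def i fmN_code)
    then show ?thesis by blast
  next
    case (2 p q r)
    then have "axN i (gnum p) (gnum q) (gnum r) 0" by (auto simp: axN_def i fmN_code)
    then show ?thesis by blast
  next
    case (3 p)
    then have "axN i (gnum p) 0 0 0"
      unfolding axN_def i by (simp add: fmN_code gnum_Bot del: gnum.simps(1))
    then show ?thesis by blast
  next
    case (4 p t x)
    then have "axN i (gnum p) (code_tm t) x 0"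
      by (auto simp: axN_def i fmN_code tmN_code ffN_code fsubN_code)
    then show ?thesis by blast
  next
    case (5 p q x)
    then have "axN i (gnum p) (gnum q) x 0"
      unfolding axN_def i not_in_fv_code by (simp add: fmN_code)
    then show ?thesis by blast
  next
    case (6 t)
    then have "axN i (code_tm t) 0 0 0" by (auto simp: axN_def i tmN_code)
    then show ?thesis by blast
  next
    case (7 p s t x)
    then have "axN i (gnum p) (code_tm s) (code_tm t) x"
      by (auto simp: axN_def i fmN_code tmN_code ffN_code fsubN_code)
    then show ?thesis by blast
  qed
next
  assume "\<exists>a b c d. axN i a b c d"
  then obtain a b c d where "axN i a b c d" by blast
  then show "\<exists>p. log_axiom p \<and> gnum p = i"
    unfolding axN_def fmN_eq_1_iff tmN_eq_1_iff
  proof (elim disjE conjE exE)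
    fix p q assume "wf_fm p" "gnum p = a" "wf_fm q" "gnum q = b" "i = impN a (impN b a)"
    then show ?thesis using log_axiom.intros(1)[of p q] by auto
  next
    fix p q r assume "wf_fm p" "gnum p = a" "wf_fm q" "gnum q = b" "wf_fm r" "gnum r = c"
      "i = impN (impN a (impN b c)) (impN (impN a b) (impN a c))"
    then show ?thesis using log_axiom.intros(2)[of p q r] by fastforce
  next
    fix p assume "wf_fm p" "gnum p = a" "i = impN (impN (impN a 0) 0) a"
    then show ?thesis using log_axiom.intros(3)[of p] gnum_Bot
      by (intro exI[of _ "Imp (Neg (Neg p)) p"]) (simp del: gnum.simps(1))
  next
    fix p t assume "wf_fm p" "gnum p = a" "wf_tm t" "code_tm t = b" "ffN b c a = 1"
      "i = impN (allN c a) (fsubN c b a)"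
    then show ?thesis using log_axiom.intros(4)[of p t c]
      by (intro exI[of _ "Imp (All c p) (subst c t p)"])
        (auto simp: ffN_code fsubN_code simp del: One_nat_def)
  next
    fix p q assume "wf_fm p" "gnum p = a" "wf_fm q" "gnum q = b"
      "fsubN c (code_tm (Fn Zero [])) a = a" "i = impN (allN c (impN a b)) (impN a (allN c b))"
    then show ?thesis using log_axiom.intros(5)[of p q c] not_in_fv_code[of c p]
      by (intro exI[of _ "Imp (All c (Imp p q)) (Imp p (All c q))"]) auto
  next
    fix t assume "wf_tm t" "code_tm t = a" "i = eqN a a"
    then show ?thesis using log_axiom.intros(6)[of t] by auto
  next
    fix p s t assume "wf_fm p" "gnum p = a" "wf_tm s" "code_tm s = b" "wf_tm t" "code_tm t = c"
      "ffN b d a = 1" "ffN c d a = 1" "i = impN (eqN b c) (impN (fsubN d b a) (fsubN d c a))"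
    then show ?thesis using log_axiom.intros(7)[of p s t d]
      by (intro exI[of _ "Imp (Eq s t) (Imp (subst d s p) (subst d t p))"])
        (auto simp: ffN_code fsubN_code simp del: One_nat_def)
  qed
qed

lemma definable_N_log_axiom: "definable_N {gnum p | p. log_axiom p}"
proof -
  have "PR 5 (\<lambda>xs. of_bool (axN (xs ! 0) (xs ! 1) (xs ! 2) (xs ! 3) (xs ! 4)))"
    unfolding axN_def by (intro pr) simp_all
  from definable_N_PR_ex4[OF this] show ?thesis
    unfolding log_axiom_code[symmetric] by (simp add: eq_commute conj_commute)
qed

section \<open>Theorems as a generated set\<close>

lemma gnum_eq_imp:
  assumes "gnum r = impN (gnum p) x"
  obtains q where "r = Imp p q" "gnum q = x"
  using assms by (cases r) (auto dest: gnum_inj)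

text \<open>Generalization is presented with its premise repeated, so that all rules are binary; the
  bound on the variable \<open>y\<close> keeps the relation primitive recursive.\<close>

definition ruleN :: "nat \<Rightarrow> nat \<Rightarrow> nat \<Rightarrow> bool" where
  "ruleN a b x \<longleftrightarrow> a = impN b x \<or> a = b \<and> (\<exists>y<x. x = allN y a)"

lemma proves_gen_by:
  "{gnum p | p. proves T p} = gen_by ({gnum p | p. log_axiom p} \<union> gnum ` T) ruleN"
proof (intro set_eqI iffI)
  fix i assume "i \<in> {gnum p | p. proves T p}"
  then obtain p where "proves T p" and i: "i = gnum p" by blast
  have ax: "gnum q \<in> gen_by ({gnum p | p. log_axiom p} \<union> gnum ` T) ruleN" if "log_axiom q" for q
    using that by (intro gen_by.base) blast
  have "gnum p \<in> gen_by ({gnum p | p. log_axiom p} \<union> gnum ` T) ruleN"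
    using \<open>proves T p\<close>
  proof (induction rule: proves.induct)
    case (hyp p)
    then show ?case by (intro gen_by.base) blast
  next
    case (mp p q)
    have "ruleN (gnum (Imp p q)) (gnum p) (gnum q)" by (simp add: ruleN_def)
    then show ?case by (rule gen_by.step[OF mp.IH])
  next
    case (gen p x)
    \<comment> \<open>The bound in \<open>ruleN\<close> excludes no instance of generalization,
      because a quantified formula has a larger code than its variable.\<close>
    have "x < gnum (All x p)"
      using pfst_psnd_less(1)[of "gnum (All x p)"] by simp
    then have "ruleN (gnum p) (gnum p) (gnum (All x p))"
      unfolding ruleN_def gnum.simps by blast
    then show ?case by (rule gen_by.step[OF gen.IH gen.IH])
  \<comment> \<open>The remaining cases are the axiom schemes.\<close>
  qed (rule ax, rule log_axiom.intros, assumption+)+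
  then show "i \<in> gen_by ({gnum p | p. log_axiom p} \<union> gnum ` T) ruleN" using i by simp
next
  fix i assume "i \<in> gen_by ({gnum p | p. log_axiom p} \<union> gnum ` T) ruleN"
  then show "i \<in> {gnum p | p. proves T p}"
  proof (induction rule: gen_by.induct)
    case (base x)
    have "log_axiom p \<Longrightarrow> proves T p" for p
      by (induction rule: log_axiom.induct) (auto intro: proves.intros)
    with base show ?case by (auto intro: proves.hyp)
  next
    case (step a b x)
    then obtain p q where pq: "proves T p" "gnum p = a" "proves T q" "gnum q = b" by auto
    from step.hyps(3) consider "a = impN b x" | y where "x = allN y a"
      unfolding ruleN_def by blast
    then show ?case
    proof cases
      case 1
      \<comment> \<open>Injectivity of the numbering forces the formula coded by \<open>a\<close> to
        be an implication with antecedent \<open>q\<close>.\<close>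
      then obtain r where "p = Imp q r" "gnum r = x" using pq gnum_eq_imp by metis
      then show ?thesis using proves.mp pq by blast
    next
      case 2
      then have "x = gnum (All y p)" using pq by simp
      then show ?thesis using proves.gen[OF pq(1)] by blast
    qed
  qed
qed

lemma definable_N_proves:
  assumes "arithmetically_definable T"
  shows "definable_N {gnum p | p. proves T p}"
proof -
  have "PR 3 (\<lambda>xs. of_bool (ruleN (xs ! 0) (xs ! 1) (xs ! 2)))"
    unfolding ruleN_def by (intro pr) auto
  then show ?thesis
    unfolding proves_gen_by using assms definable_N_log_axiom
    by (intro definable_N_gen_by definable_N_Un) (auto simp: arithmetically_definable_def)
qed


section \<open>The maps \<open>I\<close> and \<open>J\<close>\<close>

lemma wf_numeral_tm [simp]: "wf_tm (numeral_tm n)"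
  and vars_numeral_tm [simp]: "vars_tm (numeral_tm n) = {}"
  and tm_val_numeral_tm [simp]: "tm_val e (numeral_tm n) = n"
  by (induction n) auto

lemma wf_subst_tm: "wf_tm t \<Longrightarrow> wf_tm u \<Longrightarrow> wf_tm (subst_tm x u t)"
  by (induction t) auto

lemma vars_subst_tm: "vars_tm (subst_tm x u t) \<subseteq> vars_tm t - {x} \<union> vars_tm u"
  by (induction t) auto

lemma wf_subst: "wf_fm p \<Longrightarrow> wf_tm u \<Longrightarrow> wf_fm (subst x u p)"
  by (induction p) (auto simp: wf_subst_tm)

lemma fv_subst: "fv (subst x u p) \<subseteq> fv p - {x} \<union> vars_tm u"
proof (induction p)
  case (Eq s t)
  then show ?case using vars_subst_tm[of x u s] vars_subst_tm[of x u t] by auto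
qed auto

lemma tm_val_cong: "(\<And>x. x \<in> vars_tm t \<Longrightarrow> e x = e' x) \<Longrightarrow> tm_val e t = tm_val e' t"
proof (induction t)
  case (Fn f ts)
  then have "map (tm_val e) ts = map (tm_val e') ts" by (auto intro!: map_cong)
  then show ?case by (simp only: tm_val.simps)
qed simp

lemma tm_val_subst_tm: "tm_val e (subst_tm x u t) = tm_val (e(x := tm_val e u)) t"
proof (induction t)
  case (Fn f ts)
  then have "map (tm_val e \<circ> subst_tm x u) ts = map (tm_val (e(x := tm_val e u))) ts"
    by (intro map_cong) (simp_all only: o_apply)
  then show ?case by (simp only: tm_val.simps subst_tm.simps map_map)
qed simp

text \<open>A closed term cannot be captured, and its value survives the updates made by
  quantifiers.\<close>

lemma sat_subst: "vars_tm u = {} \<Longrightarrow> sat e (subst x u p) \<longleftrightarrow> sat (e(x := tm_val e u)) p"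
proof (induction p arbitrary: e)
  case (All y p)
  show ?case
  proof (cases "y = x")
    case False
    have "sat (e(y := a)) (subst x u p) \<longleftrightarrow> sat (e(x := tm_val e u, y := a)) p" for a
    proof -
      have "tm_val (e(y := a)) u = tm_val e u"
        using All.prems by (intro tm_val_cong) auto
      then show ?thesis
        using All.IH[OF All.prems, of "e(y := a)"] fun_upd_twist[OF False] by metis
    qed
    then show ?thesis using False by (simp only: subst.simps sat.simps if_False)
  next
    case True
    then show ?thesis by (simp only: subst.simps sat.simps if_True fun_upd_upd refl)
  qed
qed (auto simp: tm_val_subst_tm)

section \<open>Values of \<open>I_map\<close> and \<open>J_map\<close>\<close>

lemma v_formula_negs: "v_formula v p \<Longrightarrow> v_formula v (negs k p)"
  by (induction k) (auto simp: v_formula_def)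

lemma v_formula_phi: "i \<in> Gamma v \<Longrightarrow> v_formula v (phi v i)"
  unfolding Gamma_def using phi_gnum by auto

lemma v_formula_subst:
  "v_formula v p \<Longrightarrow> wf_tm u \<Longrightarrow> vars_tm u \<subseteq> {v} \<Longrightarrow> v_formula v (subst v u p)"
  using fv_subst[of v u p] by (auto simp: v_formula_def wf_subst)

text \<open>Stated for all strings over the alphabet, since the recursion passes to arbitrary
  tails.\<close>

lemma v_formula_I_map: "X \<in> lists (Sigma_N v) \<Longrightarrow> v_formula v (I_map v X)"
proof (induction v X rule: I_map.induct)
  case (2 v i X)
  then show ?case by (auto simp: Sigma_N_def v_formula_phi)
next
  case (4 v X)
  have "v_formula v (case dropWhile (\<lambda>a. a = Ln) X of
      La i # Y \<Rightarrow> subst v (Fn (diag_sym v) [Var v]) (phi v i) | _ \<Rightarrow> Bot)"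
  proof (cases "\<exists>i Y. dropWhile (\<lambda>a. a = Ln) X = La i # Y")
    case True
    then obtain i Y where *: "dropWhile (\<lambda>a. a = Ln) X = La i # Y" by blast
    \<comment> \<open>The index following the block of \<open>Ln\<close> comes from the string
      itself, hence lies in \<open>Gamma v\<close>.\<close>
    then have "La i \<in> set X" by (metis list.set_intros(1) set_dropWhileD)
    then have "i \<in> Gamma v" using 4 by (auto simp: Sigma_N_def)
    then show ?thesis using *
      by (auto intro!: v_formula_subst v_formula_phi simp: diag_sym)
  next
    case False
    then show ?thesis by (auto simp: v_formula_def split: list.split letter.split)
  qed
  then show ?case by (simp add: v_formula_negs)
qed (auto simp: v_formula_def)

lemma sentence_subst_numeral: "v_formula v p \<Longrightarrow> sentence (subst v (numeral_tm n) p)"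
  using fv_subst[of v "numeral_tm n" p] by (auto simp: sentence_def v_formula_def wf_subst)

lemma set_pred_part: "set (pred_part X) \<subseteq> set X"
  by (induction X rule: pred_part.induct) auto

text \<open>Every clause gives \<open>Bot\<close>, the negation of an earlier value, or a
  \<open>v\<close>-formula with a numeral substituted for \<open>v\<close>.\<close>

lemma sentence_J_map: "X \<in> lists (Sigma_N v) \<Longrightarrow> sentence (J_map v X)"
proof (induction v X rule: J_map.induct)
  case (2 v i X)
  then have "v_formula v (I_map v [La i])" by (intro v_formula_I_map) auto
  then show ?case by (simp add: sentence_subst_numeral del: I_map.simps numeral_tm.simps)
next
  case (3 v X)
  then have "v_formula v (I_map v (Lr # pred_part X))"
    using set_pred_part[of X] by (intro v_formula_I_map) (auto simp: lists_eq_set)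
  then show ?case by (simp add: sentence_subst_numeral sentence_def[of Bot] del: I_map.simps)
next
  case (4 v X)
  then have "v_formula v (I_map v (Ln # pred_part X))"
    using set_pred_part[of X] by (intro v_formula_I_map) (auto simp: lists_eq_set)
  moreover have "sentence (Neg (J_map v X))" if "arg_part X \<notin> Pred_N v"
    using 4 that by (auto simp: sentence_def)
  ultimately show ?case by (simp add: sentence_subst_numeral del: I_map.simps)
qed (simp add: sentence_def)

text \<open>If the argument of the leading predicate is itself a predicate, the negation comes from
  \<open>I_map\<close> and commutes with substitution; otherwise it is built into
  \<open>J_map\<close>.\<close>

lemma J_map_Ln:
  assumes "S \<in> Sent_N v"
  shows "J_map v (Ln # S) = Neg (J_map v S)"
proof -
  obtain H X where "S = H @ X" "H \<in> Pred_N v"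
    using assms unfolding Sent_N_def by blast
  then show ?thesis using J_map_clauses(1)[of H v X] parts_append[of H v X] by auto
qed

section \<open>Sentences of the model and their negations\<close>

lemma Pred_N_lists: "Pred_N v \<subseteq> lists (Sigma_N v)"
  by (auto simp: Pred_N_def Sigma_N_def)

lemma Sent_N_lists: "Sent_N v \<subseteq> lists (Sigma_N v)"
  using Pred_N_lists by (fastforce simp: Sent_N_def)

lemma Ln_Cons_Sent_N:
  assumes "S \<in> Sent_N v"
  shows "Ln # S \<in> Sent_N v"
proof -
  obtain Y i X where "S = (Y @ [La i]) @ X" "Y \<in> lists {Ln, Lr}" "i \<in> Gamma v" "X \<in> lists (Sigma_N v)"
    using assms unfolding Sent_N_def Pred_N_def by blast
  then have "Ln # S = ((Ln # Y) @ [La i]) @ X" "Ln # Y \<in> lists {Ln, Lr}" by auto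
  then show ?thesis
    using \<open>i \<in> Gamma v\<close> \<open>X \<in> lists (Sigma_N v)\<close> unfolding Sent_N_def Pred_N_def by blast
qed

text \<open>Read contrapositively, prefixing \<open>Ln\<close> does not lead from a non-predicate to
  a predicate.\<close>

lemma Ln_Cons_Pred_N: "Ln # S \<in> Pred_N v \<Longrightarrow> S \<in> Pred_N v"
  by (fastforce simp: Pred_N_def Cons_eq_append_conv)

lemma Sent_plus_M_N: "Sent_plus (M_N v) = Sent_N v - Pred_N v"
  by (simp add: M_N_def Sent_N_def)

lemma mem_True_plus_M_N:
  assumes "S \<in> Sent_plus (M_N v)" "true_N (J_map v S)"
  shows "S \<in> True_plus (M_N v)"
proof -
  obtain H X where "S = H @ X" "H \<in> Pred_N v" "X \<in> lists (Sigma_N v)"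
    using assms(1) unfolding Sent_plus_M_N Sent_N_def by blast
  then show ?thesis using assms by (auto simp: M_N_def Phi_N_def)
qed

text \<open>As \<open>S\<close> is a sentence but not a predicate, the one-letter predicate is
  applied to the code of \<open>J_map v S\<close>, not to that of \<open>I_map v S\<close>.\<close>

lemma Phi_N_v_formula:
  assumes "v_formula v p" "\<And>e. sat e p \<longleftrightarrow> e v \<in> A" "S \<in> Sent_plus (M_N v)"
  shows "S \<in> Phi_N v [La (gnum p)] \<longleftrightarrow> gnum (J_map v S) \<in> A"
proof -
  have S: "S \<in> Sent_N v" "S \<notin> Pred_N v" "S \<in> lists (Sigma_N v)"
    using assms(3) Sent_N_lists unfolding Sent_plus_M_N by blast+
  then have "J_map v ([La (gnum p)] @ S) = subst v (numeral_tm (gnum (J_map v S))) p"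
    by (simp add: phi_gnum[OF assms(1)])
  then show ?thesis
    using S(3) by (simp only: Phi_N_def mem_Collect_eq true_N_def sat_subst vars_numeral_tm
        tm_val_numeral_tm assms(2) fun_upd_same simp_thms)
qed

theorem theorem5p12:
  fixes v :: nat
  assumes "G1_plus (M_N v)"
  shows "\<forall>T. is_theory T \<and> arithmetically_definable T \<and> sound T \<longrightarrow> incomplete T"
proof (intro allI impI, elim conjE)
  fix T assume "arithmetically_definable T" "sound T"
  let ?A = "{gnum p | p. proves T p}"
  have A: "gnum p \<in> ?A \<longleftrightarrow> proves T p" for p by (auto dest: gnum_inj)
  obtain p where p: "v_formula v p" "\<And>e. sat e p \<longleftrightarrow> e v \<in> ?A"
    using definable_N_proves[OF \<open>arithmetically_definable T\<close>, unfolded definable_N_iff[of _ v]]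
    by (rule arithmetical_v_formula) blast
  have sent: "sentence (J_map v S)" if "S \<in> Sent_plus (M_N v)" for S
    using that Sent_N_lists sentence_J_map unfolding Sent_plus_M_N by blast
  let ?H = "[La (gnum p)]"
  have Phi: "S \<in> Phi_N v ?H \<longleftrightarrow> proves T (J_map v S)" if "S \<in> Sent_plus (M_N v)" for S
    using Phi_N_v_formula[OF p that] unfolding A .
  have "?H \<in> Pred_N v" using p(1) by (auto simp: Pred_N_def Gamma_def)
  \<comment> \<open>For \<open>S\<close> on the left, \<open>J_map v S\<close> is a provable
    sentence, hence true by soundness.\<close>
  moreover have "Phi_N v ?H \<inter> Sent_plus (M_N v) \<subseteq> True_plus (M_N v)"
    using Phi sent \<open>sound T\<close> mem_True_plus_M_N unfolding sound_def by blast
  ultimately obtain S where S: "S \<in> Sent_plus (M_N v)" "S \<notin> Phi_N v ?H" "Ln # S \<notin> Phi_N v ?H"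
    using assms unfolding M_N_def G1_plus.simps by blast
  \<comment> \<open>\<open>Phi\<close> characterizes membership only for strings in
    \<open>Sent_plus (M_N v)\<close>, so the negated string must be placed there too.\<close>
  have "Ln # S \<in> Sent_plus (M_N v)"
    using S(1) Ln_Cons_Sent_N Ln_Cons_Pred_N by (auto simp: Sent_plus_M_N)
  then have "\<not> proves T (Neg (J_map v S))"
    using S Phi J_map_Ln[of S v] by (auto simp: Sent_plus_M_N)
  moreover have "\<not> proves T (J_map v S)" using S Phi by blast
  ultimately show "incomplete T" using sent[OF S(1)] unfolding incomplete_def by blast
qed

end
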